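(* Let $d\ge 2$, let $\lambda=(\lambda_1,\ldots,\lambda_d)$ with $\lambda_i>-\frac12$ for $1\le i\le d$, write $|\lambda|=\lambda_1+\cdots+\lambda_d$, and let $\mathbf{1}=(1,\ldots,1)\in\mathbb{R}^d$ and $\sigma_\lambda=\Gamma(|\lambda|+d)/\prod_{i=1}^d\Gamma(\lambda_i+1)$. Then for every integer $n\ge 0$ and every $x\in[-1,1]^d$, $$P_n(W_\lambda;x,\mathbf{1})=\sum_{m=0}^{\min\{\lfloor n/2\rfloor,\,d-1\}}(-1)^m\binom{d-1}{m}\,\sigma_\lambda\int_{\mathcal{T}^d}Z_{n-2m}^{|\lambda|+d-1}(\langle x,y\rangle)\prod_{i=1}^d y_i^{\lambda_i}\,dy .$$ Furthermore, $$K_n^{d-2}(W_\lambda;x,\mathbf{1})=\frac{1}{\binom{n+d-2}{n}}\sum_{m=0}^{\min\{n,\,d-1\}}\binom{d-1}{m}\,\sigma_\lambda\int_{\mathcal{T}^d}Z_{n-m}^{|\lambda|+d-1}(\langle x,y\rangle)\prod_{i=1}^d y_i^{\lambda_i}\,dy .$$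
   Context: For $\nu>-\frac12$, $w_\nu(t)=(1-t^2)^{\nu-1/2}$ on $(-1,1)$ and $c_\nu$ is the constant with $c_\nu\int_{-1}^1 w_\nu(t)\,dt=1$. $C_n^\nu$ is the Gegenbauer polynomial: orthogonal with respect to $w_\nu$, of degree $n$, with $C_n^\nu(1)=\binom{n+2\nu-1}{n}$; $Z_n^\nu(t)=\frac{n+\nu}{\nu}C_n^\nu(t)$ (limit $\nu\to 0$ if $\nu=0$). The product Gegenbauer weight on $[-1,1]^d$ is $W_\lambda(x)=\prod_{i=1}^d c_{\lambda_i}w_{\lambda_i}(x_i)$, so $\int_{[-1,1]^d}W_\lambda=1$. $\mathcal{V}_n^d(W_\lambda)$ is the space of polynomials of degree $n$ in $d$ variables that are orthogonal to all polynomials of lower degree with respect to $\langle f,g\rangle=\int_{[-1,1]^d} f g\,W_\lambda\,dx$ (together with $0$). $P_n(W_\lambda;x,y)=\sum_j P_j^n(x)P_j^n(y)$, for any orthonormal basis $\{P_j^n\}$ of $\mathcal{V}_n^d(W_\lambda)$, is its reproducing kernel. The Cesàro $(C,\delta)$ kernel is $$K_n^\delta(W_\lambda;x,y)=\frac{1}{\binom{n+\delta}{n}}\sum_{k=0}^n\binom{n-k+\delta}{n-k}P_k(W_\lambda;x,y).$$ $\mathcal{T}^d=\{y\in\mathbb{R}^d: y_i\ge0,\ y_1+\cdots+y_d=1\}$, and $\int_{\mathcal{T}^d}g(y)\,dy$ means integration with respect to Lebesgue measure $dy_1\cdots dy_{d-1}$ over $\{y_i\ge 0,\ y_1+\cdots+y_{d-1}\le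 1\}$ with $y_d=1-y_1-\cdots-y_{d-1}$. $\langle x,y\rangle=\sum_i x_iy_i$. *)

theory Defs
  imports "HOL-Analysis.Analysis"
begin

definition geg_weight :: "real \<Rightarrow> real \<Rightarrow> real" where
  "geg_weight \<nu> t = (1 - t\<^sup>2) powr (\<nu> - 1/2)"

definition geg_const :: "real \<Rightarrow> real" where
  "geg_const \<nu> = 1 / (LINT t:{-1<..<1}|lborel. geg_weight \<nu> t)"

text \<open>
  For \<open>\<nu> > -1/2\<close>, \<open>\<nu> \<noteq> 0\<close>, the polynomial below exists and is unique. For \<open>\<nu> = 0\<close>, \<open>n \<ge> 1\<close> the
  prescribed value at 1 is 0, no such polynomial exists and \<open>gegenbauer\<close> is unspecified;
  \<open>geg_Z\<close> is then the limit \<open>\<nu> \<rightarrow> 0\<close>.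
\<close>

definition gegenbauer :: "real \<Rightarrow> nat \<Rightarrow> real poly" where
  "gegenbauer \<nu> n = (THE p. degree p = n \<and>
     (\<forall>q. degree q < n \<longrightarrow> (LINT t:{-1<..<1}|lborel. poly p t * poly q t * geg_weight \<nu> t) = 0) \<and>
     poly p 1 = (real n + 2 * \<nu> - 1) gchoose n)"

definition geg_Z :: "real \<Rightarrow> nat \<Rightarrow> real \<Rightarrow> real" where
  "geg_Z \<nu> n t =
     (if \<nu> = 0 then Lim (at 0) (\<lambda>\<mu>. (real n + \<mu>) / \<mu> * poly (gegenbauer \<mu> n) t)
      else (real n + \<nu>) / \<nu> * poly (gegenbauer \<nu> n) t)"

text \<open>
  Points of \<open>\<real>\<^sup>d\<close> are functions \<open>nat \<Rightarrow> real\<close> of which only the values at \<open>1, \<dots>, d\<close> matter.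
  Lebesgue measure on \<open>\<real>\<^sup>d\<close> is the product measure on the extensional functions over \<open>{1..d}\<close>.
\<close>

definition prod_weight :: "nat \<Rightarrow> (nat \<Rightarrow> real) \<Rightarrow> (nat \<Rightarrow> real) \<Rightarrow> real" where
  "prod_weight d l x = (\<Prod>i=1..d. geg_const (l i) * geg_weight (l i) (x i))"

definition cube_inner ::
  "nat \<Rightarrow> (nat \<Rightarrow> real) \<Rightarrow> ((nat \<Rightarrow> real) \<Rightarrow> real) \<Rightarrow> ((nat \<Rightarrow> real) \<Rightarrow> real) \<Rightarrow> real" where
  "cube_inner d l f g =
     (LINT x:({1..d} \<rightarrow>\<^sub>E {-1..1})|(\<Pi>\<^sub>M i\<in>{1..d}. lborel). f x * g x * prod_weight d l x)"

definition multi_indices :: "nat \<Rightarrow> nat \<Rightarrow> (nat \<Rightarrow> nat) set" where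
  "multi_indices d n = {\<alpha> \<in> {1..d} \<rightarrow>\<^sub>E {0..n}. (\<Sum>i=1..d. \<alpha> i) \<le> n}"

text \<open>
  Polynomials in \<open>d\<close> variables are identified with polynomial functions; \<open>poly_funs d n\<close> are those
  of total degree at most \<open>n\<close>.
\<close>

definition poly_funs :: "nat \<Rightarrow> nat \<Rightarrow> ((nat \<Rightarrow> real) \<Rightarrow> real) set" where
  "poly_funs d n =
     {p. \<exists>c. p = (\<lambda>x. \<Sum>\<alpha>\<in>multi_indices d n. c \<alpha> * (\<Prod>i=1..d. x i ^ \<alpha> i))}"

definition orth_polys :: "nat \<Rightarrow> (nat \<Rightarrow> real) \<Rightarrow> nat \<Rightarrow> ((nat \<Rightarrow> real) \<Rightarrow> real) set" where
  "orth_polys d l n =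
     {p \<in> poly_funs d n. (p = (\<lambda>x. 0) \<or> (\<forall>m<n. p \<notin> poly_funs d m)) \<and>
        (\<forall>m<n. \<forall>q\<in>poly_funs d m. cube_inner d l p q = 0)}"

definition orthonormal_basis ::
  "nat \<Rightarrow> (nat \<Rightarrow> real) \<Rightarrow> nat \<Rightarrow> ((nat \<Rightarrow> real) \<Rightarrow> real) set \<Rightarrow> bool" where
  "orthonormal_basis d l n B \<longleftrightarrow>
     finite B \<and> B \<subseteq> orth_polys d l n \<and>
     (\<forall>p\<in>B. \<forall>q\<in>B. cube_inner d l p q = (if p = q then 1 else 0)) \<and>
     (\<forall>f\<in>orth_polys d l n. \<exists>a. f = (\<lambda>x. \<Sum>p\<in>B. a p * p x))"

text \<open>
  The common value over all orthonormal bases. The description determines a number only if such a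
  basis exists and the sum does not depend on it.
\<close>

definition repr_kernel ::
  "nat \<Rightarrow> (nat \<Rightarrow> real) \<Rightarrow> nat \<Rightarrow> (nat \<Rightarrow> real) \<Rightarrow> (nat \<Rightarrow> real) \<Rightarrow> real" where
  "repr_kernel d l n x y =
     (THE s. \<forall>B. orthonormal_basis d l n B \<longrightarrow> s = (\<Sum>p\<in>B. p x * p y))"

definition cesaro_kernel ::
  "nat \<Rightarrow> (nat \<Rightarrow> real) \<Rightarrow> real \<Rightarrow> nat \<Rightarrow> (nat \<Rightarrow> real) \<Rightarrow> (nat \<Rightarrow> real) \<Rightarrow> real" where
  "cesaro_kernel d l \<delta> n x y =
     1 / ((real n + \<delta>) gchoose n) *
     (\<Sum>k=0..n. ((real (n - k) + \<delta>) gchoose (n - k)) * repr_kernel d l k x y)"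

definition simplex_integral :: "nat \<Rightarrow> ((nat \<Rightarrow> real) \<Rightarrow> real) \<Rightarrow> real" where
  "simplex_integral d g =
     (LINT y:{y \<in> {1..<d} \<rightarrow>\<^sub>E {0..}. (\<Sum>i\<in>{1..<d}. y i) \<le> 1}|(\<Pi>\<^sub>M i\<in>{1..<d}. lborel).
        g (y(d := 1 - (\<Sum>i\<in>{1..<d}. y i))))"

definition simplex_const :: "nat \<Rightarrow> (nat \<Rightarrow> real) \<Rightarrow> real" where
  "simplex_const d l = Gamma ((\<Sum>i=1..d. l i) + real d) / (\<Prod>i=1..d. Gamma (l i + 1))"

end

theory Submission
  imports Defs
begin

text \<open>
  Write \<open>Z\<^sub>n(t)\<close> for the zonal polynomial of the weight with parameter \<open>\<nu>\<close>, that is,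
  \<open>p\<^sub>n(t) p\<^sub>n(1)\<close> for the orthonormal polynomial \<open>p\<^sub>n\<close> of degree \<open>n\<close>. Its generating function is
  \<open>\<Sum>\<^sub>n Z\<^sub>n(t) r\<^sup>n = (1 - r\<^sup>2) / (1 - 2tr + r\<^sup>2) powr (\<nu> + 1)\<close>.

  An orthonormal basis of the orthogonal polynomials of degree \<open>n\<close> on the cube consists of the products
  \<open>\<Prod>\<^sub>i p\<^sub>\<alpha>\<^sub>i(x\<^sub>i)\<close> with \<open>\<Sum>\<^sub>i \<alpha>\<^sub>i = n\<close>. At the corner \<open>(1, \<dots>, 1)\<close> each factor of the reproducing kernel
  becomes a zonal polynomial, so that the kernel there is the coefficient of \<open>r\<^sup>n\<close> in
  \<open>(1 - r\<^sup>2)\<^sup>d \<Prod>\<^sub>i (1 - 2 x\<^sub>i r + r\<^sup>2) powr (- \<lambda>\<^sub>i - 1)\<close>.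

  The product of powers is a single average over the simplex: the moments of the Dirichlet distribution
  give the formula of Liouville and Feynman,
  \<open>\<Prod>\<^sub>i a\<^sub>i powr (- \<lambda>\<^sub>i - 1) = \<sigma> \<integral> (\<Sum>\<^sub>i y\<^sub>i a\<^sub>i) powr (- |\<lambda>| - d) \<Prod>\<^sub>i y\<^sub>i powr \<lambda>\<^sub>i dy\<close>.
  For \<open>a\<^sub>i = 1 - 2 x\<^sub>i r + r\<^sup>2\<close> the convex combination \<open>\<Sum>\<^sub>i y\<^sub>i a\<^sub>i\<close> equals \<open>1 - 2 \<langle>x,y\<rangle> r + r\<^sup>2\<close>, again the
  denominator of a zonal generating function, now with parameter \<open>|\<lambda>| + d - 1\<close>. One factor \<open>1 - r\<^sup>2\<close>
  completes this generating function, and the remaining factor \<open>(1 - r\<^sup>2)^(d - 1)\<close> expands into the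
  alternating sum of the first identity. The Cesaro weights of order \<open>d - 2\<close> are the coefficients of
  \<open>1 / (1 - r)^(d - 1)\<close>. Multiplying by this series leaves \<open>(1 + r)^(d - 1)\<close>, which gives the second identity.

  All series are treated as formal power series in \<open>r\<close>, so that each coefficient involves finitely many
  moments of the Dirichlet distribution and no limit has to be interchanged with an integral. The
  one-variable input is the generating function (\<open>zonal_generating\<close>) and the orthogonality of the zonal
  polynomials (\<open>geg_int_zonal_zonal\<close>), the passage to the cube is \<open>repr_kernel_one\<close>, the averaging is
  \<open>dirichlet_mean_geg_poly\<close>, and \<open>repr_kernel_generating\<close> puts the generating functions together.
\<close>

section \<open>Gegenbauer polynomials and their zonal normalisation\<close>

text \<open>
  The classical three-term recurrence, normalised by the generating function
  \<open>(1 - 2tr + r\<^sup>2) powr (- \<mu>)\<close>. For \<open>\<mu> > 0\<close> this is the Gegenbauer polynomial \<open>C\<^sub>n\<close> with parameter \<open>\<mu>\<close>. The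
  recursion makes sense for every real \<open>\<mu>\<close> and gives the properties below by induction on the degree.
\<close>

fun geg_poly :: "real \<Rightarrow> nat \<Rightarrow> real poly" where
  "geg_poly \<mu> 0 = 1"
| "geg_poly \<mu> (Suc 0) = [:0, 2 * \<mu>:]"
| "geg_poly \<mu> (Suc (Suc n)) =
     smult (2 * (real n + 1 + \<mu>) / (real n + 2)) (pCons 0 (geg_poly \<mu> (Suc n)))
     - smult ((real n + 2 * \<mu>) / (real n + 2)) (geg_poly \<mu> n)"

declare geg_poly.simps(3) [simp del]

lemma geg_poly_SucSuc:
  "smult (real n + 2) (geg_poly \<mu> (Suc (Suc n))) =
     smult (2 * (real n + 1 + \<mu>)) (pCons 0 (geg_poly \<mu> (Suc n)))
     - smult (real n + 2 * \<mu>) (geg_poly \<mu> n)"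
  unfolding geg_poly.simps(3) smult_diff_right smult_smult
  by (simp add: add_eq_0_iff)

text \<open>
  The preceding polynomial, with the convention that the polynomial of index \<open>- 1\<close> vanishes. With it the
  recurrences hold from index 0 on.
\<close>

definition geg_prev :: "real \<Rightarrow> nat \<Rightarrow> real poly" where
  "geg_prev \<mu> n = (if n = 0 then 0 else geg_poly \<mu> (n - 1))"

lemma geg_prev_simps [simp]: "geg_prev \<mu> 0 = 0" "geg_prev \<mu> (Suc n) = geg_poly \<mu> n"
  by (simp_all add: geg_prev_def)

lemma geg_poly_Suc:
  "(real n + 1) * poly (geg_poly \<mu> (Suc n)) t =
     2 * (real n + \<mu>) * t * poly (geg_poly \<mu> n) t - (real n + 2 * \<mu> - 1) * poly (geg_prev \<mu> n) t"
proof (cases n)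
  case (Suc m)
  show ?thesis
    using arg_cong[OF geg_poly_SucSuc[of m \<mu>], of "\<lambda>p. poly p t"] by (simp add: Suc algebra_simps)
qed simp

text \<open>
  The derivative is expressed without changing the parameter, so the formula follows from the three-term
  recurrence by induction: differentiate the recurrence, insert both induction hypotheses and eliminate
  the polynomial of lowest index.
\<close>

lemma geg_poly_deriv:
  "(1 - t\<^sup>2) * poly (pderiv (geg_poly \<mu> n)) t =
     (real n + 2 * \<mu> - 1) * poly (geg_prev \<mu> n) t - real n * t * poly (geg_poly \<mu> n) t"
proof (induction \<mu> n rule: geg_poly.induct)
  case (3 \<mu> n)
  define c where "c = poly (geg_poly \<mu> n) t"
  define c1 where "c1 = poly (geg_poly \<mu> (Suc n)) t"
  define p where "p = poly (geg_prev \<mu> n) t"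
  define d where "d = poly (pderiv (geg_poly \<mu> n)) t"
  define d1 where "d1 = poly (pderiv (geg_poly \<mu> (Suc n))) t"
  define m where "m = real n"
  have m: "m + 2 \<noteq> 0" by (simp add: m_def)
  have IH0: "(1 - t\<^sup>2) * d = (m + 2 * \<mu> - 1) * p - m * t * c"
    using 3(2) by (simp add: c_def d_def p_def m_def)
  have IH1: "(1 - t\<^sup>2) * d1 = (m + 2 * \<mu>) * c - (m + 1) * t * c1"
    using 3(1) by (simp add: c_def c1_def d1_def m_def algebra_simps)
  have r: "(m + 1) * c1 = 2 * (m + \<mu>) * t * c - (m + 2 * \<mu> - 1) * p"
    using geg_poly_Suc[of n \<mu> t] by (simp add: c_def c1_def p_def m_def)
  have r2: "(m + 2) * poly (geg_poly \<mu> (Suc (Suc n))) t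
      = 2 * (m + 1 + \<mu>) * t * c1 - (m + 2 * \<mu>) * c"
    using arg_cong[OF geg_poly_SucSuc[of n \<mu>], of "\<lambda>p. poly p t"]
    by (simp add: c_def c1_def m_def)
  have "(m + 2) * poly (pderiv (geg_poly \<mu> (Suc (Suc n)))) t
     = 2 * (m + 1 + \<mu>) * c1 + t * (2 * (m + 1 + \<mu>) * d1) - (m + 2 * \<mu>) * d"
    using arg_cong[OF geg_poly_SucSuc[of n \<mu>], of "\<lambda>p. poly (pderiv p) t"]
    by (simp add: c_def c1_def d1_def d_def m_def pderiv_diff pderiv_smult pderiv_pCons)
  then have "(m + 2) * ((1 - t\<^sup>2) * poly (pderiv (geg_poly \<mu> (Suc (Suc n)))) t)
     = (1 - t\<^sup>2) * (2 * (m + 1 + \<mu>) * c1 + t * (2 * (m + 1 + \<mu>) * d1) - (m + 2 * \<mu>) * d)"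
    by (simp only: mult.left_commute[of "m + 2" "1 - t\<^sup>2"])
  also have "\<dots> = 2 * (m + 1 + \<mu>) * ((1 - t\<^sup>2) * c1 + t * ((m + 2 * \<mu>) * c - (m + 1) * t * c1))
       - (m + 2 * \<mu>) * ((2 * (m + \<mu>) * t * c - (m + 1) * c1) - m * t * c)"
    using IH0 IH1 r by algebra
  also have "\<dots> = (m + 2) * ((m + 2 + 2 * \<mu> - 1) * c1)
       - (m + 2) * t * (2 * (m + 1 + \<mu>) * t * c1 - (m + 2 * \<mu>) * c)"
    by algebra
  also note r2 [symmetric]
  finally have "(m + 2) * ((1 - t\<^sup>2) * poly (pderiv (geg_poly \<mu> (Suc (Suc n)))) t) =
     (m + 2) * ((m + 2 + 2 * \<mu> - 1) * c1 - (m + 2) * t * poly (geg_poly \<mu> (Suc (Suc n))) t)"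
    by (simp only: right_diff_distrib mult.assoc mult.left_commute)
  then show ?case using m by (simp only: mult_cancel_left) (simp add: c1_def m_def add_ac)
qed (simp_all add: pderiv_pCons power2_eq_square algebra_simps)

text \<open>
  For \<open>\<nu> \<noteq> 0\<close> this is \<open>(n + \<nu>) / \<nu> * C\<^sub>n\<close> with \<open>C\<^sub>n\<close> of parameter \<open>\<nu>\<close>. Written as a difference of polynomials of
  parameter \<open>\<nu> + 1\<close> it involves no division by \<open>\<nu>\<close>, so the limiting case \<open>\<nu> = 0\<close> needs no separate
  treatment. The index of the subtracted polynomial is \<open>n - 2\<close>. Truncated subtraction gives 0 for \<open>n < 2\<close>.
\<close>

definition zonal :: "real \<Rightarrow> nat \<Rightarrow> real poly" where
  "zonal \<nu> n = geg_poly (\<nu> + 1) n - geg_prev (\<nu> + 1) (n - 1)"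

lemma zonal_Suc:
  "(real n + 1) * poly (zonal \<nu> (Suc n)) t =
     2 * (real n + (\<nu> + 1)) * (t * poly (geg_poly (\<nu> + 1) n) t - poly (geg_prev (\<nu> + 1) n) t)"
  using geg_poly_Suc[of n "\<nu> + 1" t] by (simp add: zonal_def algebra_simps)

text \<open>
  Write \<open>c\<^sub>n\<close> for \<open>geg_poly (\<nu> + 1) n\<close>. Together with \<open>zonal_Suc\<close> this splits multiplication by the variable:
  \<open>t * c\<^sub>n - c\<^sub>n\<^sub>-\<^sub>1\<close> is proportional to
  the zonal polynomial of degree \<open>n + 1\<close> and \<open>c\<^sub>n - t * c\<^sub>n\<^sub>-\<^sub>1\<close> to the one of degree \<open>n\<close>.
\<close>

lemma zonal_eq_prev:
  "(real n + 2 * \<nu>) * poly (zonal \<nu> n) t =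
     2 * (real n + \<nu>) * (poly (geg_poly (\<nu> + 1) n) t - t * poly (geg_prev (\<nu> + 1) n) t)"
proof (cases n)
  case (Suc m)
  show ?thesis using geg_poly_Suc[of m "\<nu> + 1" t]
    by (simp add: zonal_def Suc) algebra
qed (simp add: zonal_def)

lemma degree_geg_poly_le: "degree (geg_poly \<mu> n) \<le> n"
proof (induction \<mu> n rule: geg_poly.induct)
  case (3 \<mu> n)
  then have "degree (pCons 0 (geg_poly \<mu> (Suc n))) \<le> Suc (Suc n)"
    by (meson Suc_le_mono degree_pCons_le order_trans)
  with 3 show ?case unfolding geg_poly.simps(3)
    by (intro degree_diff_le order_trans[OF degree_smult_le]) auto
qed simp_all

lemma coeff_geg_poly_pos: "\<mu> > 0 \<Longrightarrow> coeff (geg_poly \<mu> n) n > 0"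
proof (induction \<mu> n rule: geg_poly.induct)
  case (3 \<mu> n)
  have "coeff (geg_poly \<mu> n) (Suc (Suc n)) = 0"
    using degree_geg_poly_le[of \<mu> n] by (intro coeff_eq_0) auto
  with 3 show ?case by (simp add: geg_poly.simps(3))
qed simp_all

lemma degree_zonal:
  assumes "\<nu> > - (1/2)"
  shows "degree (zonal \<nu> n) = n"
proof (rule antisym)
  have "degree (geg_prev (\<nu> + 1) (n - 1)) \<le> n"
    using degree_geg_poly_le[of "\<nu> + 1" "n - Suc (Suc 0)"] by (auto simp: geg_prev_def)
  then show "degree (zonal \<nu> n) \<le> n"
    unfolding zonal_def by (intro degree_diff_le degree_geg_poly_le)
  have "coeff (geg_prev (\<nu> + 1) (n - 1)) n = 0"
    using degree_geg_poly_le[of "\<nu> + 1" "n - Suc (Suc 0)"] by (auto simp: geg_prev_def intro!: coeff_eq_0)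
  with coeff_geg_poly_pos[of "\<nu> + 1" n] assms have "coeff (zonal \<nu> n) n \<noteq> 0"
    by (simp add: zonal_def)
  then show "n \<le> degree (zonal \<nu> n)" by (rule le_degree)
qed

lemma zonal_0 [simp]: "zonal \<nu> 0 = 1"
  by (simp add: zonal_def)

lemma sum_zonal: "(\<Sum>k\<le>n. zonal \<nu> k) = geg_poly (\<nu> + 1) n + geg_prev (\<nu> + 1) n"
  by (induction n) (simp_all add: zonal_def)

text \<open>
  At the endpoint the left-hand side of the derivative formula vanishes.
\<close>

lemma poly_geg_poly_1:
  "real n * poly (geg_poly \<mu> n) 1 = (real n + 2 * \<mu> - 1) * poly (geg_prev \<mu> n) 1"
  using geg_poly_deriv[of 1 \<mu> n] by simp

lemma poly_geg_poly_1_pos: "\<mu> > 0 \<Longrightarrow> poly (geg_poly \<mu> n) 1 > 0"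
proof (induction n)
  case (Suc n)
  have "(real n + 1) * poly (geg_poly \<mu> (Suc n)) 1 = (real n + 2 * \<mu>) * poly (geg_poly \<mu> n) 1"
    using poly_geg_poly_1[of "Suc n" \<mu>] by (simp add: algebra_simps)
  moreover have "(real n + 2 * \<mu>) * poly (geg_poly \<mu> n) 1 > 0" using Suc by simp
  ultimately show ?case by (metis of_nat_0_le_iff add_nonneg_pos zero_less_mult_pos zero_less_one)
qed simp

lemma poly_geg_poly_1_eq: "poly (geg_poly \<mu> n) 1 = pochhammer (2 * \<mu>) n / fact n"
proof (induction n)
  case (Suc n)
  have "(real n + 1) * poly (geg_poly \<mu> (Suc n)) 1 = (real n + 2 * \<mu>) * poly (geg_poly \<mu> n) 1"
    using poly_geg_poly_1[of "Suc n" \<mu>] by (simp add: algebra_simps)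
  also have "\<dots> = pochhammer (2 * \<mu>) (Suc n) / fact n" unfolding Suc by (simp add: pochhammer_Suc mult_ac add_ac)
  finally have "poly (geg_poly \<mu> (Suc n)) 1 = pochhammer (2 * \<mu>) (Suc n) / fact n / (real n + 1)"
    by (metis nonzero_mult_div_cancel_left of_nat_Suc of_nat_neq_0 add.commute)
  then show ?case by (simp add: field_simps)
qed simp

lemma zonal_at_1:
  "(real n + 2 * \<nu>) * (real n + 2 * \<nu> + 1) * poly (zonal \<nu> n) 1 =
     2 * (real n + \<nu>) * (2 * \<nu> + 1) * poly (geg_poly (\<nu> + 1) n) 1"
  using zonal_eq_prev[of n \<nu> 1] poly_geg_poly_1[of n "\<nu> + 1"] by simp algebra

lemma zonal_at_1_pos:
  assumes "\<nu> > - (1/2)"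
  shows "poly (zonal \<nu> n) 1 > 0"
proof (cases n)
  case (Suc m)
  have "2 * (real n + \<nu>) * (2 * \<nu> + 1) * poly (geg_poly (\<nu> + 1) n) 1 > 0"
    using assms Suc poly_geg_poly_1_pos[of "\<nu> + 1" n] by simp
  moreover have "(real n + 2 * \<nu>) * (real n + 2 * \<nu> + 1) > 0"
    using assms Suc by simp
  ultimately show ?thesis using zonal_at_1[of n \<nu>] by (metis zero_less_mult_pos)
qed simp

lemma zonal_at_1_eq:
  assumes "\<nu> > 0"
  shows "poly (zonal \<nu> n) 1 = (real n + \<nu>) / \<nu> * ((real n + 2 * \<nu> - 1) gchoose n)"
proof -
  define A where "A = pochhammer (2 * \<nu>) n"
  have "pochhammer (2 * \<nu>) (Suc (Suc n)) = 2 * \<nu> * ((2 * \<nu> + 1) * pochhammer (2 * (\<nu> + 1)) n)"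
    by (simp only: pochhammer_rec) (simp add: algebra_simps)
  then have "2 * \<nu> * ((2 * \<nu> + 1) * pochhammer (2 * (\<nu> + 1)) n)
     = A * (2 * \<nu> + real n) * (2 * \<nu> + (real n + 1))"
    by (simp add: pochhammer_Suc A_def algebra_simps)
  then have "(real n + 2 * \<nu>) * (real n + 2 * \<nu> + 1) * (\<nu> * poly (zonal \<nu> n) 1) =
     (real n + 2 * \<nu>) * (real n + 2 * \<nu> + 1) * ((real n + \<nu>) * (A / fact n))"
    using zonal_at_1[of n \<nu>] unfolding poly_geg_poly_1_eq by (simp add: field_simps) algebra
  moreover have "(real n + 2 * \<nu>) * (real n + 2 * \<nu> + 1) \<noteq> 0"
    using assms by (simp add: add_nonneg_eq_0_iff)
  ultimately have "\<nu> * poly (zonal \<nu> n) 1 = (real n + \<nu>) * (A / fact n)"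
    by (metis mult_cancel_left)
  moreover have "(real n + 2 * \<nu> - 1) gchoose n = A / fact n"
    by (simp add: gbinomial_pochhammer' A_def algebra_simps)
  ultimately show ?thesis using assms by (simp only: nonzero_eq_divide_eq times_divide_eq_left) (simp add: field_simps)
qed

section \<open>Orthogonality and the reproducing property in one variable\<close>

text \<open>
  The affine map \<open>t \<mapsto> (1 + t) / 2\<close> turns the weight into a multiple of the Beta density with both parameters
  equal to \<open>\<nu> + 1/2\<close>. This gives integrability and total mass.
\<close>

lemma geg_weight_Beta:
  assumes "t \<in> {-1<..<1}"
  shows "geg_weight \<nu> t =
    2 powr (2 * \<nu> - 1) * ((1/2 + 1/2 * t) powr ((\<nu> + 1/2) - 1) * (1 - (1/2 + 1/2 * t)) powr ((\<nu> + 1/2) - 1))"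
proof -
  have "1 - t\<^sup>2 = 4 * ((1/2 + 1/2 * t) * (1 - (1/2 + 1/2 * t)))"
    by (simp add: power2_eq_square field_simps)
  moreover have "(4::real) powr (\<nu> - (1/2)) = 2 powr (2 * \<nu> - 1)"
  proof -
    have "(4::real) powr (\<nu> - (1/2)) = (2 powr 2) powr (\<nu> - (1/2))" by simp
    also have "\<dots> = 2 powr (2 * \<nu> - 1)" by (subst powr_powr) (simp add: algebra_simps)
    finally show ?thesis .
  qed
  ultimately show ?thesis using assms unfolding geg_weight_def
    by (simp add: powr_mult)
qed

lemma
  assumes "\<nu> > - (1/2)"
  shows set_integrable_geg_weight: "set_integrable lborel {-1<..<1} (geg_weight \<nu>)" (is ?A)
    and integral_geg_weight_pos: "(LINT t:{-1<..<1}|lborel. geg_weight \<nu> t) > 0" (is ?B)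
proof -
  define a where "a = \<nu> + 1/2"
  have a: "a > 0" using assms by (simp add: a_def)
  define f where "f = (\<lambda>s. indicator {0..1} s *\<^sub>R (s powr (a - 1) * (1 - s) powr (a - 1)) :: real)"
  have f: "integrable lborel f"
    using integrable_Beta[OF a a] by (simp add: f_def set_integrable_def)
  have fi: "integral\<^sup>L lborel f = Beta a a"
    using set_borel_integral_eq_integral(2)[OF integrable_Beta[OF a a]] has_integral_Beta_real[OF a a]
    by (simp add: f_def set_lebesgue_integral_def integral_unique)
  have eq: "AE t in lborel. indicator {-1<..<1} t *\<^sub>R geg_weight \<nu> t = 2 powr (2 * \<nu> - 1) * f (1/2 + 1/2 * t)"
    using AE_lborel_singleton[of "1::real"] AE_lborel_singleton[of "-1::real"]
  proof eventually_elim
    case (elim t)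
    show ?case
    proof (cases "t \<in> {-1<..<1}")
      case True
      then show ?thesis using geg_weight_Beta[OF True, of \<nu>] by (simp add: f_def a_def)
    next
      case False
      then have "1/2 + 1/2 * t \<notin> {0..1}" using elim by auto
      then show ?thesis using False by (simp add: f_def)
    qed
  qed
  have i: "integrable lborel (\<lambda>t. 2 powr (2 * \<nu> - 1) * f (1/2 + 1/2 * t))"
    by (intro integrable_mult_right lborel_integrable_real_affine f) simp
  have m: "(\<lambda>t. indicator {-1<..<1} t *\<^sub>R geg_weight \<nu> t) \<in> borel_measurable lborel"
    unfolding geg_weight_def by measurable
  show ?A unfolding set_integrable_def
    using integrable_cong_AE[OF m borel_measurable_integrable[OF i] eq] i by simp
  have "(LINT t:{-1<..<1}|lborel. geg_weight \<nu> t) = (LINT t|lborel. 2 powr (2 * \<nu> - 1) * f (1/2 + 1/2 * t))"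
    unfolding set_lebesgue_integral_def
    by (rule integral_cong_AE[OF m borel_measurable_integrable[OF i] eq])
  also have "\<dots> = 2 powr (2 * \<nu> - 1) * (2 * Beta a a)"
    using lborel_integral_real_affine[of "1/2" f "1/2"] by (simp add: fi)
  also have "\<dots> > 0" using a by (simp add: Beta_def Gamma_real_pos)
  finally show ?B .
qed

text \<open>
  A linear functional of one polynomial rather than a bilinear form: the inner product of \<open>p\<close> and \<open>q\<close> is
  \<open>geg_int \<nu> (p * q)\<close>.
\<close>

definition geg_int :: "real \<Rightarrow> real poly \<Rightarrow> real" where
  "geg_int \<nu> p = geg_const \<nu> * (LINT t:{-1<..<1}|lborel. poly p t * geg_weight \<nu> t)"

lemma set_integrable_poly_geg_weight:
  assumes "\<nu> > - (1/2)"
  shows "set_integrable lborel {-1<..<1} (\<lambda>t. poly p t * geg_weight \<nu> t)"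
proof -
  have "compact (poly p ` {-1..1})"
    by (intro compact_continuous_image continuous_intros) auto
  then obtain B where B: "\<And>t. t \<in> {-1..1} \<Longrightarrow> \<bar>poly p t\<bar> \<le> B"
    by (force dest!: compact_imp_bounded simp: bounded_iff)
  have "set_integrable lborel {-1<..<1} (\<lambda>t. B * geg_weight \<nu> t)"
    using set_integrable_geg_weight[OF assms] by simp
  then show ?thesis unfolding set_integrable_def
  proof (rule Bochner_Integration.integrable_bound)
    have [measurable]: "poly p \<in> borel_measurable borel"
      by (intro borel_measurable_continuous_onI continuous_intros)
    show "(\<lambda>t. indicator {-1<..<1} t *\<^sub>R (poly p t * geg_weight \<nu> t)) \<in> borel_measurable lborel"
      unfolding geg_weight_def by measurable
    show "AE t in lborel. norm (indicator {-1<..<1} t *\<^sub>R (poly p t * geg_weight \<nu> t))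
       \<le> norm (indicator {-1<..<1} t *\<^sub>R (B * geg_weight \<nu> t))"
    proof (rule AE_I2)
      fix t :: real
      show "norm (indicator {-1<..<1} t *\<^sub>R (poly p t * geg_weight \<nu> t))
       \<le> norm (indicator {-1<..<1} t *\<^sub>R (B * geg_weight \<nu> t))"
        using B[of t] by (auto simp: indicator_def abs_mult intro!: mult_right_mono)
    qed
  qed
qed

lemma geg_const_pos: "\<nu> > - (1/2) \<Longrightarrow> geg_const \<nu> > 0"
  using integral_geg_weight_pos by (simp add: geg_const_def)

lemma geg_int_1: "\<nu> > - (1/2) \<Longrightarrow> geg_int \<nu> 1 = 1"
  using integral_geg_weight_pos[of \<nu>] by (simp add: geg_int_def geg_const_def)

lemma geg_int_add:
  "\<nu> > - (1/2) \<Longrightarrow> geg_int \<nu> (p + q) = geg_int \<nu> p + geg_int \<nu> q"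
  by (simp add: geg_int_def distrib_right distrib_left set_integral_add(2) set_integrable_poly_geg_weight)

lemma geg_int_smult: "geg_int \<nu> (smult c p) = c * geg_int \<nu> p"
  by (simp add: geg_int_def mult.assoc)

lemma geg_int_0 [simp]: "geg_int \<nu> 0 = 0"
  by (simp add: geg_int_def)

lemma geg_int_diff:
  "\<nu> > - (1/2) \<Longrightarrow> geg_int \<nu> (p - q) = geg_int \<nu> p - geg_int \<nu> q"
  using geg_int_add[of \<nu> p "- q"] geg_int_smult[of \<nu> "-1" q] by simp

lemma geg_int_sum:
  "\<nu> > - (1/2) \<Longrightarrow> geg_int \<nu> (\<Sum>i\<in>A. p i) = (\<Sum>i\<in>A. geg_int \<nu> (p i))"
  by (induction A rule: infinite_finite_induct) (simp_all add: geg_int_add)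

lemma real_poly_ext: "(\<And>t. poly p t = poly q (t::real)) \<Longrightarrow> p = q"
  using poly_eq_poly_eq_iff by blast

text \<open>
  The product of the weight and a zonal polynomial of positive degree \<open>k + 1\<close> has an explicit
  antiderivative, a multiple of \<open>(1 - t\<^sup>2) powr (\<nu> + 1/2)\<close> times \<open>geg_poly (\<nu> + 1) k\<close>. It vanishes at both
  endpoints because \<open>\<nu> + 1/2 > 0\<close>. The weight may be unbounded there, hence the version of the fundamental
  theorem that needs differentiability in the interior only.
\<close>

lemma geg_int_zonal:
  assumes "\<nu> > - (1/2)" "n > 0"
  shows "geg_int \<nu> (zonal \<nu> n) = 0"
proof -
  obtain k where n: "n = Suc k" using assms by (cases n) auto
  define c where "c = geg_poly (\<nu> + 1) k"
  define F where "F = (\<lambda>t. (1 - t\<^sup>2) powr (\<nu> + 1/2) * poly c t)"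
  define q where "q = c * [:0, - (2 * \<nu> + 1):] + [:1, 0, -1:] * pderiv c"
  \<comment> \<open>Here \<open>q\<close> is the polynomial for which the derivative of \<open>F\<close> is \<open>q\<close> times the weight.\<close>
  have F': "(F has_real_derivative poly q t * geg_weight \<nu> t) (at t)" if t: "t \<in> {-1<..<1}" for t
  proof -
    have t2: "1 - t\<^sup>2 > 0" using t by (simp add: abs_square_less_1 abs_less_iff)
    have "(1 - t\<^sup>2) powr (\<nu> + 1/2) = (1 - t\<^sup>2) * geg_weight \<nu> t"
      using t2 powr_add[of "1 - t\<^sup>2" 1 "\<nu> - (1/2)"] by (simp add: geg_weight_def add.commute)
    note eq = this
    have "(F has_real_derivative (\<nu> + 1/2) * geg_weight \<nu> t * (- 2 * t) * poly c t
        + (1 - t\<^sup>2) powr (\<nu> + 1/2) * poly (pderiv c) t) (at t)"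
      unfolding F_def geg_weight_def using t2
      by (auto intro!: derivative_eq_intros poly_DERIV)
    also have "(\<nu> + 1/2) * geg_weight \<nu> t * (- 2 * t) * poly c t
        + (1 - t\<^sup>2) powr (\<nu> + 1/2) * poly (pderiv c) t = poly q t * geg_weight \<nu> t"
      unfolding eq by (simp add: q_def power2_eq_square algebra_simps)
    finally show ?thesis .
  qed
  have "((\<lambda>t. poly q t * geg_weight \<nu> t) has_integral F 1 - F (-1)) {-1..1}"
  proof (rule fundamental_theorem_of_calculus_interior)
    show "continuous_on {- 1..1} F" unfolding F_def using assms
      by (intro continuous_intros continuous_on_powr') (auto simp: abs_square_le_1 abs_le_iff)
    show "(F has_vector_derivative poly q t * geg_weight \<nu> t) (at t)" if "t \<in> {-1<..<1}" for t
      using F'[OF that] by (simp add: has_real_derivative_iff_has_vector_derivative)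
  qed simp
  then have "((\<lambda>t. poly q t * geg_weight \<nu> t) has_integral 0) {-1<..<1}"
    by (simp add: F_def has_integral_Icc_iff_Ioo)
  then have "geg_int \<nu> q = 0"
    using set_borel_integral_eq_integral(2)[OF set_integrable_poly_geg_weight[OF assms(1), of q]]
    by (simp add: geg_int_def integral_unique)
  moreover have "smult (2 * (real k + (\<nu> + 1))) q = smult (- (real k + 2 * \<nu> + 1) * (real k + 1)) (zonal \<nu> n)"
  proof (rule real_poly_ext)
    fix t
    have "poly q t = (1 - t\<^sup>2) * poly (pderiv c) t - (2 * \<nu> + 1) * t * poly c t"
      by (simp add: q_def power2_eq_square algebra_simps)
    then show "poly (smult (2 * (real k + (\<nu> + 1))) q) t = poly (smult (- (real k + 2 * \<nu> + 1) * (real k + 1)) (zonal \<nu> n)) t"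
      using geg_poly_deriv[of t "\<nu> + 1" k] zonal_Suc[of k \<nu> t]
      by (simp add: c_def n) algebra
  qed
  ultimately have "- (real k + 2 * \<nu> + 1) * (real k + 1) * geg_int \<nu> (zonal \<nu> n) = 0"
    by (metis geg_int_smult mult_zero_right)
  then show ?thesis using assms by auto
qed

lemma geg_poly_minus_eq_zonal:
  assumes "\<nu> > - (1/2)"
  shows "\<exists>b. geg_poly (\<nu> + 1) n - pCons 0 (geg_prev (\<nu> + 1) n) = smult b (zonal \<nu> n)"
proof (cases n)
  case 0
  then show ?thesis by (auto intro: exI[of _ 1])
next
  case (Suc m)
  have nz: "2 * (real n + \<nu>) \<noteq> 0" using assms Suc by simp
  have "geg_poly (\<nu> + 1) n - pCons 0 (geg_prev (\<nu> + 1) n)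
      = smult ((real n + 2 * \<nu>) / (2 * (real n + \<nu>))) (zonal \<nu> n)"
    by (rule real_poly_ext) (use zonal_eq_prev[of n \<nu>] nz in \<open>simp add: field_simps\<close>)
  then show ?thesis ..
qed

lemma geg_poly_minus_eq_zonal_Suc:
  assumes "\<nu> > - (1/2)"
  shows "\<exists>a. pCons 0 (geg_poly (\<nu> + 1) n) - geg_prev (\<nu> + 1) n = smult a (zonal \<nu> (Suc n))"
proof -
  have nz: "2 * (real n + (\<nu> + 1)) \<noteq> 0" using assms by simp
  have "pCons 0 (geg_poly (\<nu> + 1) n) - geg_prev (\<nu> + 1) n
     = smult ((real n + 1) / (2 * (real n + (\<nu> + 1)))) (zonal \<nu> (Suc n))"
  proof (rule real_poly_ext)
    fix t
    show "poly (pCons 0 (geg_poly (\<nu> + 1) n) - geg_prev (\<nu> + 1) n) t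
      = poly (smult ((real n + 1) / (2 * (real n + (\<nu> + 1)))) (zonal \<nu> (Suc n))) t"
      using zonal_Suc[of n \<nu> t] nz by (simp add: divide_simps mult_ac)
  qed
  then show ?thesis ..
qed

lemma zonal_three_term:
  assumes "\<nu> > - (1/2)"
  shows "\<exists>a b. pCons 0 (zonal \<nu> (Suc n)) = smult a (zonal \<nu> (Suc (Suc n))) + smult b (zonal \<nu> n)"
proof -
  obtain a b where
    "pCons 0 (geg_poly (\<nu> + 1) (Suc n)) - geg_poly (\<nu> + 1) n = smult a (zonal \<nu> (Suc (Suc n)))"
    "geg_poly (\<nu> + 1) n - pCons 0 (geg_prev (\<nu> + 1) n) = smult b (zonal \<nu> n)"
    using geg_poly_minus_eq_zonal[OF assms, of n] geg_poly_minus_eq_zonal_Suc[OF assms, of "Suc n"] by auto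
  moreover have "pCons 0 (zonal \<nu> (Suc n)) =
      (pCons 0 (geg_poly (\<nu> + 1) (Suc n)) - geg_poly (\<nu> + 1) n)
    + (geg_poly (\<nu> + 1) n - pCons 0 (geg_prev (\<nu> + 1) n))"
    by (simp add: zonal_def)
  ultimately show ?thesis by metis
qed

text \<open>
  With the three-term recurrence a factor \<open>t\<close> can be moved from \<open>q\<close> to the zonal polynomial, at the cost of
  changing its degree by one in either direction. Induction on \<open>q\<close> thus reduces orthogonality to the
  vanishing of the integrals of zonal polynomials of positive degree.
\<close>

lemma zonal_orthogonal:
  assumes "\<nu> > - (1/2)" "degree q < n"
  shows "geg_int \<nu> (zonal \<nu> n * q) = 0"
  using assms(2)
proof (induction q arbitrary: n)
  case 0
  then show ?case by simp
next
  case (pCons a q)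
  obtain m where n: "n = Suc m" using pCons.prems by (cases n) auto
  have const: "geg_int \<nu> (zonal \<nu> n * [:a:]) = 0"
    using geg_int_zonal[OF assms(1), of n] n by (simp add: geg_int_smult)
  show ?case
  proof (cases "q = 0")
    case False
    then have d: "degree q < m" "degree q < Suc (Suc m)" using pCons.prems n by auto
    obtain b c where bc: "pCons 0 (zonal \<nu> n) = smult b (zonal \<nu> (Suc (Suc m))) + smult c (zonal \<nu> m)"
      using zonal_three_term[OF assms(1)] n by blast
    have "zonal \<nu> n * pCons a q = zonal \<nu> n * [:a:] + pCons 0 (zonal \<nu> n) * q"
      by (simp add: algebra_simps)
    also have "\<dots> = zonal \<nu> n * [:a:] + (smult b (zonal \<nu> (Suc (Suc m)) * q) + smult c (zonal \<nu> m * q))"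
      by (simp add: bc distrib_right)
    finally show ?thesis
      using pCons.IH[OF d(1)] pCons.IH[OF d(2)] const assms(1)
      by (simp only: geg_int_add geg_int_smult mult_zero_right add_0)
  qed (use const in simp)
qed

text \<open>
  The sum \<open>S\<close> of the zonal polynomials of degree at most \<open>n\<close> satisfies a Christoffel-Darboux identity:
  \<open>(t - 1) * S\<close> is a combination of the zonal polynomials of degrees \<open>n + 1\<close> and \<open>n\<close>, hence orthogonal to all
  polynomials of degree less than \<open>n\<close>. Splitting \<open>q\<close> as \<open>q(1) + (t - 1) * r\<close> leaves the constant part.
\<close>

lemma sum_zonal_reproducing:
  assumes "\<nu> > - (1/2)" "degree q \<le> n"
  shows "geg_int \<nu> ((\<Sum>k\<le>n. zonal \<nu> k) * q) = poly q 1"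
proof -
  define S where "S = (\<Sum>k\<le>n. zonal \<nu> k)"
  define r where "r = synthetic_div q 1"
  have q: "q = [:poly q 1:] + [:-1, 1:] * r"
    using synthetic_div_correct'[of 1 q] by (simp add: r_def add.commute)
  have "geg_int \<nu> S = (\<Sum>k\<le>n. if k = 0 then 1 else 0)"
    unfolding S_def geg_int_sum[OF assms(1)]
    by (intro sum.cong) (auto simp: geg_int_zonal geg_int_1 assms)
  then have S1: "geg_int \<nu> S = 1" by simp
  have Sr: "geg_int \<nu> (S * ([:-1, 1:] * r)) = 0"
  proof (cases "degree q = 0")
    case True
    then have "r = 0" by (simp add: r_def synthetic_div_eq_0_iff)
    then show ?thesis by simp
  next
    case False
    then have d: "degree r < n" "degree r < Suc n"
      using assms(2) by (auto simp: r_def degree_synthetic_div)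
    obtain a b where ab:
      "pCons 0 (geg_poly (\<nu> + 1) n) - geg_prev (\<nu> + 1) n = smult a (zonal \<nu> (Suc n))"
      "geg_poly (\<nu> + 1) n - pCons 0 (geg_prev (\<nu> + 1) n) = smult b (zonal \<nu> n)"
      using geg_poly_minus_eq_zonal[OF assms(1), of n] geg_poly_minus_eq_zonal_Suc[OF assms(1), of n] by auto
    have "S * [:-1, 1:] = smult a (zonal \<nu> (Suc n)) - smult b (zonal \<nu> n)"
      unfolding ab [symmetric] S_def sum_zonal by simp
    then have "S * ([:-1, 1:] * r) = smult a (zonal \<nu> (Suc n) * r) - smult b (zonal \<nu> n * r)"
      by (simp only: mult.assoc [symmetric] left_diff_distrib mult_smult_left)
    then show ?thesis
      using zonal_orthogonal[OF assms(1) d(1)] zonal_orthogonal[OF assms(1) d(2)]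
      by (simp add: geg_int_diff assms geg_int_smult)
  qed
  have "S * q = smult (poly q 1) S + S * ([:-1, 1:] * r)"
    by (subst q) (simp add: distrib_left)
  then show ?thesis using S1 Sr by (simp add: geg_int_add geg_int_smult assms(1) S_def)
qed

text \<open>
  The norms come for free from the reproducing property: testing it on a zonal polynomial kills all
  terms but one by orthogonality, so the squared norm is the value at 1.
\<close>

lemma geg_int_zonal_zonal:
  assumes "\<nu> > - (1/2)"
  shows "geg_int \<nu> (zonal \<nu> n * zonal \<nu> m) = (if n = m then poly (zonal \<nu> n) 1 else 0)"
proof -
  have neq: "geg_int \<nu> (zonal \<nu> n * zonal \<nu> m) = 0" if "n \<noteq> m" for n m
    using that zonal_orthogonal[OF assms, of "zonal \<nu> m" n] zonal_orthogonal[OF assms, of "zonal \<nu> n" m]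
    by (cases "n < m") (auto simp: degree_zonal assms mult.commute[of "zonal \<nu> m"])
  have "poly (zonal \<nu> n) 1 = (\<Sum>k\<le>n. geg_int \<nu> (zonal \<nu> k * zonal \<nu> n))"
    using sum_zonal_reproducing[OF assms, of "zonal \<nu> n" n]
    by (simp add: degree_zonal assms sum_distrib_right geg_int_sum)
  also have "\<dots> = (\<Sum>k\<le>n. if k = n then geg_int \<nu> (zonal \<nu> n * zonal \<nu> n) else 0)"
    by (intro sum.cong) (auto simp: neq)
  finally show ?thesis using neq by auto
qed

lemma zonal_span:
  assumes "\<nu> > - (1/2)" "degree p \<le> n"
  shows "\<exists>a. p = (\<Sum>k\<le>n. smult (a k) (zonal \<nu> k))"
  using assms(2)
proof (induction n arbitrary: p)
  case 0
  then obtain c where "p = [:c:]" by (metis degree_eq_zeroE le_zero_eq)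
  then show ?case by (intro exI[of _ "\<lambda>_. c"]) simp
next
  case (Suc n)
  have nz: "coeff (zonal \<nu> (Suc n)) (Suc n) \<noteq> 0"
    using degree_zonal[OF assms(1), of "Suc n"] by (metis degree_0 leading_coeff_0_iff nat.distinct(1))
  define c where "c = coeff p (Suc n) / coeff (zonal \<nu> (Suc n)) (Suc n)"
  have "degree (p - smult c (zonal \<nu> (Suc n))) \<le> n"
  proof (rule degree_le, intro allI impI)
    fix i assume "i > n"
    then show "coeff (p - smult c (zonal \<nu> (Suc n))) i = 0"
      using nz Suc.prems degree_zonal[OF assms(1), of "Suc n"]
      by (cases "i = Suc n") (auto simp: c_def coeff_eq_0)
  qed
  from Suc.IH[OF this] obtain a where a: "p - smult c (zonal \<nu> (Suc n)) = (\<Sum>k\<le>n. smult (a k) (zonal \<nu> k))"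
    by blast
  have "p = (\<Sum>k\<le>n. smult (a k) (zonal \<nu> k)) + smult c (zonal \<nu> (Suc n))"
    using a by (metis diff_add_cancel)
  also have "(\<Sum>k\<le>n. smult (a k) (zonal \<nu> k)) = (\<Sum>k\<le>n. smult ((a(Suc n := c)) k) (zonal \<nu> k))"
    by (intro sum.cong) auto
  also have "\<dots> + smult c (zonal \<nu> (Suc n)) = (\<Sum>k\<le>Suc n. smult ((a(Suc n := c)) k) (zonal \<nu> k))"
    unfolding sum.atMost_Suc by simp
  finally show ?case by blast
qed

lemma zonal_expansion:
  assumes "\<nu> > - (1/2)" "degree p \<le> n"
  shows "p = (\<Sum>k\<le>n. smult (geg_int \<nu> (p * zonal \<nu> k) / poly (zonal \<nu> k) 1) (zonal \<nu> k))"
proof -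
  obtain a where a: "p = (\<Sum>k\<le>n. smult (a k) (zonal \<nu> k))" using zonal_span[OF assms] by blast
  have "geg_int \<nu> (p * zonal \<nu> k) / poly (zonal \<nu> k) 1 = a k" if "k \<le> n" for k
  proof -
    have "geg_int \<nu> (p * zonal \<nu> k) = (\<Sum>j\<le>n. a j * (if j = k then poly (zonal \<nu> j) 1 else 0))"
      unfolding a sum_distrib_right
      by (simp add: geg_int_sum assms geg_int_smult geg_int_zonal_zonal)
    also have "\<dots> = a k * poly (zonal \<nu> k) 1" using that by (simp add: sum.delta if_distrib cong: if_cong)
    finally show ?thesis using zonal_at_1_pos[OF assms(1), of k] by simp
  qed
  then have "(\<Sum>k\<le>n. smult (geg_int \<nu> (p * zonal \<nu> k) / poly (zonal \<nu> k) 1) (zonal \<nu> k))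
     = (\<Sum>k\<le>n. smult (a k) (zonal \<nu> k))"
    by (intro sum.cong) auto
  from trans[OF a this[symmetric]] show ?thesis .
qed

lemma geg_int_eq_0_iff:
  "\<nu> > - (1/2) \<Longrightarrow> geg_int \<nu> (p * q) = 0 \<longleftrightarrow> (LINT t:{-1<..<1}|lborel. poly p t * poly q t * geg_weight \<nu> t) = 0"
  using geg_const_pos[of \<nu>] by (simp add: geg_int_def)

text \<open>
  The expansion in zonal polynomials shows that a polynomial of degree \<open>n\<close> orthogonal to all lower degrees
  is a multiple of the zonal one. The prescribed value at 1, which is positive for \<open>\<nu> > 0\<close>, fixes the factor.
\<close>

lemma gegenbauer_eq_zonal:
  assumes "\<nu> > 0"
  shows "gegenbauer \<nu> n = smult (\<nu> / (real n + \<nu>)) (zonal \<nu> n)"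
proof -
  have nu: "\<nu> > - (1/2)" using assms by simp
  define b where "b = (real n + 2 * \<nu> - 1) gchoose n"
  have z1: "poly (zonal \<nu> n) 1 = (real n + \<nu>) / \<nu> * b"
    using zonal_at_1_eq[OF assms] by (simp add: b_def)
  have pos: "real n + \<nu> > 0" "poly (zonal \<nu> n) 1 > 0" using assms zonal_at_1_pos[OF nu, of n] by auto
  show ?thesis unfolding gegenbauer_def b_def [symmetric] geg_int_eq_0_iff[OF nu, symmetric]
  proof (rule the_equality, intro conjI allI impI)
    show "degree (smult (\<nu> / (real n + \<nu>)) (zonal \<nu> n)) = n"
      using pos assms by (simp add: degree_zonal nu)
    show "geg_int \<nu> (smult (\<nu> / (real n + \<nu>)) (zonal \<nu> n) * q) = 0" if "degree q < n" for q
      using zonal_orthogonal[OF nu that] by (simp add: geg_int_smult)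
    show "poly (smult (\<nu> / (real n + \<nu>)) (zonal \<nu> n)) 1 = b"
      using z1 pos assms by (simp add: field_simps)
  next
    fix p
    assume p: "degree p = n \<and> (\<forall>q. degree q < n \<longrightarrow> geg_int \<nu> (p * q) = 0) \<and> poly p 1 = b"
    define c where "c = geg_int \<nu> (p * zonal \<nu> n) / poly (zonal \<nu> n) 1"
    have "p = (\<Sum>k\<le>n. smult (geg_int \<nu> (p * zonal \<nu> k) / poly (zonal \<nu> k) 1) (zonal \<nu> k))"
      by (rule zonal_expansion[OF nu]) (use p in simp)
    also have "\<dots> = (\<Sum>k\<le>n. if k = n then smult c (zonal \<nu> n) else 0)"
      using p by (intro sum.cong) (auto simp: c_def degree_zonal[OF nu] le_less)
    finally have pc: "p = smult c (zonal \<nu> n)" by simp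
    have "c * poly (zonal \<nu> n) 1 = b" using p pc by (metis poly_smult)
    moreover have "b \<noteq> 0" using z1 pos(2) by auto
    moreover have "b * (c * (real n + \<nu>)) = b * \<nu>"
      using calculation assms by (simp add: z1 field_simps)
    ultimately have "c * (real n + \<nu>) = \<nu>" by simp
    then have "c = \<nu> / (real n + \<nu>)" using pos assms by (simp add: field_simps)
    then show "p = smult (\<nu> / (real n + \<nu>)) (zonal \<nu> n)" using pc by simp
  qed
qed

lemma geg_Z_eq_zonal:
  assumes "\<nu> > 0"
  shows "geg_Z \<nu> n t = poly (zonal \<nu> n) t"
proof -
  have "real n + \<nu> \<noteq> 0" using assms by linarith
  then show ?thesis using assms by (simp add: geg_Z_def gegenbauer_eq_zonal)
qed

section \<open>Products of power series and sums over compositions\<close>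

text \<open>
  The compositions of \<open>n\<close> into parts indexed by \<open>I\<close>. Extensionality makes each of them a unique function.
\<close>

definition compositions :: "nat set \<Rightarrow> nat \<Rightarrow> (nat \<Rightarrow> nat) set" where
  "compositions I n = {\<alpha> \<in> extensional I. (\<Sum>i\<in>I. \<alpha> i) = n}"

lemma finite_compositions:
  assumes "finite I"
  shows "finite (compositions I n)"
proof (rule finite_subset)
  show "compositions I n \<subseteq> (\<Pi>\<^sub>E i\<in>I. {..n})"
    using member_le_sum[OF _ _ assms] by (auto simp: compositions_def PiE_iff extensional_def)
qed (use assms in \<open>auto intro: finite_PiE\<close>)

text \<open>
  The Cauchy product with any finite number of factors. The coefficient ring is general because both real
  coefficients and coefficients that are themselves power series occur below.
\<close>

lemma fps_nth_prod_compositions: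
  fixes f :: "nat \<Rightarrow> nat \<Rightarrow> 'a::comm_ring_1"
  assumes "finite I"
  shows "fps_nth (\<Prod>i\<in>I. Abs_fps (f i)) n = (\<Sum>\<alpha>\<in>compositions I n. \<Prod>i\<in>I. f i (\<alpha> i))"
  using assms
proof (induction I arbitrary: n)
    case empty
    have "compositions {} n = (if n = 0 then {\<lambda>_. undefined} else {})"
      by (auto simp: compositions_def)
    then show ?case by simp
  next
    case (insert a I)
    have "fps_nth (\<Prod>i\<in>insert a I. Abs_fps (f i)) n
        = (\<Sum>j=0..n. f a j * (\<Sum>\<alpha>\<in>compositions I (n - j). \<Prod>i\<in>I. f i (\<alpha> i)))"
      using insert by (simp add: fps_mult_nth)
    also have "\<dots> = (\<Sum>(j, \<alpha>)\<in>Sigma {0..n} (\<lambda>j. compositions I (n - j)). f a j * (\<Prod>i\<in>I. f i (\<alpha> i)))"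
      by (simp add: sum_distrib_left sum.Sigma finite_compositions insert(1))
    also have "\<dots> = (\<Sum>\<alpha>\<in>compositions (insert a I) n. \<Prod>i\<in>insert a I. f i (\<alpha> i))"
    proof (rule sum.reindex_bij_witness[where i = "\<lambda>\<alpha>. (\<alpha> a, \<alpha>(a := undefined))" and j = "\<lambda>(j, \<alpha>). \<alpha>(a := j)"])
      have upd: "(\<Sum>i\<in>I. (\<alpha>(a := j)) i) = (\<Sum>i\<in>I. \<alpha> i)" for \<alpha> :: "nat \<Rightarrow> nat" and j
        using insert by (intro sum.cong) auto
      fix p assume p: "p \<in> Sigma {0..n} (\<lambda>j. compositions I (n - j))"
      then obtain j \<alpha> where pj: "p = (j, \<alpha>)" "j \<le> n" "\<alpha> \<in> compositions I (n - j)" by auto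
      then show "(\<lambda>\<alpha>. (\<alpha> a, \<alpha>(a := undefined))) ((\<lambda>(j, \<alpha>). \<alpha>(a := j)) p) = p"
        using insert by (auto simp: compositions_def extensional_def fun_eq_iff)
      show "(\<lambda>(j, \<alpha>). \<alpha>(a := j)) p \<in> compositions (insert a I) n"
        using pj insert upd[of \<alpha> j] by (auto simp: compositions_def extensional_def)
      have "(\<Prod>i\<in>I. f i ((\<alpha>(a := j)) i)) = (\<Prod>i\<in>I. f i (\<alpha> i))"
        using insert by (intro prod.cong) auto
      then show "(\<Prod>i\<in>insert a I. f i ((\<lambda>(j, \<alpha>). \<alpha>(a := j)) p i)) = (case p of (j, \<alpha>) \<Rightarrow> f a j * (\<Prod>i\<in>I. f i (\<alpha> i)))"
        using pj insert by simp
    next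
      fix \<alpha> assume al: "\<alpha> \<in> compositions (insert a I) n"
      have upd: "(\<Sum>i\<in>I. (\<alpha>(a := undefined)) i) = (\<Sum>i\<in>I. \<alpha> i)"
        using insert by (intro sum.cong) auto
      show "(\<lambda>(j, \<alpha>). \<alpha>(a := j)) (\<alpha> a, \<alpha>(a := undefined)) = \<alpha>" by simp
      show "(\<alpha> a, \<alpha>(a := undefined)) \<in> Sigma {0..n} (\<lambda>j. compositions I (n - j))"
        using al insert upd by (auto simp: compositions_def extensional_def)
    qed
    finally show ?case .
qed

text \<open>
  The multinomial theorem in the form \<open>exp (\<Sum>\<^sub>i z\<^sub>i) = \<Prod>\<^sub>i exp z\<^sub>i\<close>, where the exponential series is graded by an
  auxiliary outer variable. Here the \<open>z\<^sub>i\<close> are themselves power series, and the multinomial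
  coefficients appear when a coefficient of the right-hand side is read off.
\<close>

lemma multinomial_exponential:
  fixes z :: "nat \<Rightarrow> real fps"
  assumes "finite I"
  shows "Abs_fps (\<lambda>k. fps_const (1 / fact k) * (\<Sum>i\<in>I. z i) ^ k) =
    (\<Prod>i\<in>I. Abs_fps (\<lambda>k. fps_const (1 / fact k) * z i ^ k))"
  using assms
proof (induction I)
  case empty
  show ?case by (rule fps_ext) (simp add: power_0_left)
next
  case (insert a I)
  define w where "w = (\<Sum>i\<in>I. z i)"
  have "Abs_fps (\<lambda>k. fps_const (1 / fact k) * (z a + w) ^ k) =
     Abs_fps (\<lambda>k. fps_const (1 / fact k) * z a ^ k) * Abs_fps (\<lambda>k. fps_const (1 / fact k) * w ^ k)"
  proof (rule fps_ext)
    fix n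
    have "fps_const (1 / fact n) * (z a + w) ^ n =
      (\<Sum>k\<le>n. fps_const (1 / fact n) * of_nat (n choose k) * (z a ^ k * w ^ (n - k)))"
      by (simp add: binomial_ring sum_distrib_left mult.assoc)
    also have "\<dots> = (\<Sum>k\<le>n. fps_const (1 / fact k) * z a ^ k * (fps_const (1 / fact (n - k)) * w ^ (n - k)))"
    proof (intro sum.cong refl)
      fix k assume "k \<in> {..n}"
      then have "1 / fact n * real (n choose k) = 1 / fact k * (1 / fact (n - k))"
        by (simp add: binomial_fact)
      then have "fps_const (1 / fact n) * of_nat (n choose k) = fps_const (1 / fact k) * fps_const (1 / fact (n - k) :: real)"
        by (simp add: fps_of_nat [symmetric])
      then show "fps_const (1 / fact n) * of_nat (n choose k) * (z a ^ k * w ^ (n - k)) =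
         fps_const (1 / fact k) * z a ^ k * (fps_const (1 / fact (n - k)) * w ^ (n - k))"
        by (simp add: mult_ac)
    qed
    finally show "fps_nth (Abs_fps (\<lambda>k. fps_const (1 / fact k) * (z a + w) ^ k)) n =
       fps_nth (Abs_fps (\<lambda>k. fps_const (1 / fact k) * z a ^ k) * Abs_fps (\<lambda>k. fps_const (1 / fact k) * w ^ k)) n"
      by (simp add: fps_mult_nth atLeast0AtMost)
  qed
  with insert show ?case by (simp add: w_def)
qed

text \<open>
  A power series \<open>\<Sum>\<^sub>k A\<^sub>k s\<^sup>k\<close> whose coefficients \<open>A\<^sub>k\<close> are power series of order at least \<open>k\<close>. For such a series
  the substitution \<open>s = 1\<close> is a finite sum in each coefficient, and it is compatible with products. In
  this way a product of compositions of power series is reduced to a Cauchy product.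
\<close>

definition graded :: "'a::comm_ring_1 fps fps \<Rightarrow> bool" where
  "graded A \<longleftrightarrow> (\<forall>k n. n < k \<longrightarrow> fps_nth (fps_nth A k) n = 0)"

definition eval_outer_one :: "'a::comm_ring_1 fps fps \<Rightarrow> 'a fps" where
  "eval_outer_one A = Abs_fps (\<lambda>n. \<Sum>k\<le>n. fps_nth (fps_nth A k) n)"

lemma graded_mult: "graded A \<Longrightarrow> graded B \<Longrightarrow> graded (A * B)"
  unfolding graded_def fps_mult_nth fps_sum_nth
proof (intro allI impI sum.neutral ballI)
  fix k n i j :: nat
  assume A: "\<forall>k n. n < k \<longrightarrow> fps_nth (fps_nth A k) n = 0" "\<forall>k n. n < k \<longrightarrow> fps_nth (fps_nth B k) n = 0"
    and "n < k" "i \<in> {0..k}" "j \<in> {0..n}"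
  then have "j < i \<or> n - j < k - i" by auto
  then show "fps_nth (fps_nth A i) j * fps_nth (fps_nth B (k - i)) (n - j) = 0" using A by auto
qed

lemma eval_outer_one_extend:
  assumes "graded A" "n \<le> N"
  shows "fps_nth (eval_outer_one A) n = (\<Sum>k\<le>N. fps_nth (fps_nth A k) n)"
  using assms unfolding eval_outer_one_def graded_def fps_nth_Abs_fps
  by (intro sum.mono_neutral_left) auto

lemma sum_triangle_extend:
  fixes f :: "nat \<Rightarrow> nat \<Rightarrow> 'a::comm_monoid_add"
  assumes "\<And>i j. i + j > n \<Longrightarrow> f i j = 0"
  shows "(\<Sum>k\<le>n. \<Sum>i\<le>k. f i (k - i)) = (\<Sum>i\<le>n. \<Sum>j\<le>n. f i j)"
proof -
  have "(\<Sum>k\<le>n. \<Sum>i\<le>k. f i (k - i)) = (\<Sum>(i, j)\<in>{(i, j). i + j \<le> n}. f i j)"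
    by (rule sum.triangle_reindex_eq [symmetric])
  also have "\<dots> = (\<Sum>(i, j)\<in>{..n} \<times> {..n}. f i j)"
    using assms by (intro sum.mono_neutral_left) (auto simp flip: not_less)
  finally show ?thesis by (simp add: sum.cartesian_product)
qed

lemma eval_outer_one_mult:
  assumes A: "graded A" and B: "graded B"
  shows "eval_outer_one (A * B) = eval_outer_one A * eval_outer_one B"
proof (rule fps_ext)
  fix n
  define F where "F = (\<lambda>i j m. fps_nth (fps_nth A i) m * fps_nth (fps_nth B j) (n - m))"
  have F0: "F i j m = 0" if "m \<le> n" "i + j > n" for i j m
  proof -
    have "m < i \<or> n - m < j" using that by auto
    then show ?thesis using A B by (auto simp: F_def graded_def)
  qed
  have "fps_nth (eval_outer_one (A * B)) n = (\<Sum>k\<le>n. \<Sum>i\<le>k. \<Sum>m\<le>n. F i (k - i) m)"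
    by (simp add: eval_outer_one_def fps_mult_nth fps_sum_nth F_def atLeast0AtMost)
  also have "\<dots> = (\<Sum>i\<le>n. \<Sum>j\<le>n. \<Sum>m\<le>n. F i j m)"
    by (rule sum_triangle_extend) (auto intro!: sum.neutral F0)
  also have "\<dots> = (\<Sum>m\<le>n. \<Sum>i\<le>n. \<Sum>j\<le>n. F i j m)"
    by (subst (2) sum.swap, subst sum.swap) simp
  also have "\<dots> = (\<Sum>m\<le>n. fps_nth (eval_outer_one A) m * fps_nth (eval_outer_one B) (n - m))"
    by (intro sum.cong refl) (simp add: F_def eval_outer_one_extend[OF A, of _ n] eval_outer_one_extend[OF B, of _ n] sum_product)
  finally show "fps_nth (eval_outer_one (A * B)) n = fps_nth (eval_outer_one A * eval_outer_one B) n"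
    by (simp add: fps_mult_nth atLeast0AtMost)
qed

lemma eval_outer_one_prod:
  fixes A :: "'i \<Rightarrow> 'a::comm_ring_1 fps fps"
  assumes "finite I" "\<And>i. i \<in> I \<Longrightarrow> graded (A i)"
  shows "graded (\<Prod>i\<in>I. A i) \<and> eval_outer_one (\<Prod>i\<in>I. A i) = (\<Prod>i\<in>I. eval_outer_one (A i))"
  using assms
proof (induction I)
  case empty
  have "fps_nth (eval_outer_one 1) n = fps_nth (1 :: 'a fps) n" for n
    by (simp add: eval_outer_one_def if_distrib[of "\<lambda>x. fps_nth x n"] cong: if_cong)
  then show ?case by (auto simp: graded_def fps_eq_iff)
qed (simp add: graded_mult eval_outer_one_mult)

lemma fps_nth_power_below:
  fixes u :: "'a::comm_ring_1 fps"
  assumes "fps_nth u 0 = 0" "n < k"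
  shows "fps_nth (u ^ k) n = 0"
  using startsby_zero_power_prefix[OF assms(1)] assms(2) by auto

text \<open>
  The power series of \<open>(1 - u) powr (- \<mu>)\<close>, meaningful when \<open>u\<close> has no constant term.
\<close>

definition neg_power :: "real \<Rightarrow> real fps \<Rightarrow> real fps" where
  "neg_power \<mu> u = fps_compose (Abs_fps (\<lambda>k. pochhammer \<mu> k / fact k)) u"

lemma neg_power_eq_eval_outer_one:
  fixes \<mu> :: real and u :: "real fps"
  assumes "fps_nth u 0 = 0"
  defines "A \<equiv> Abs_fps (\<lambda>k. fps_const (pochhammer \<mu> k / fact k) * u ^ k)"
  shows "graded A" "neg_power \<mu> u = eval_outer_one A"
  using fps_nth_power_below[OF assms(1)]
  by (auto simp: graded_def A_def neg_power_def eval_outer_one_def fps_eq_iff fps_compose_nth atLeast0AtMost)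

text \<open>
  The differential equation of the binomial series, \<open>(1 - X) f' = \<mu> f\<close>, transported by the chain rule.
\<close>

lemma neg_power_deriv:
  assumes "fps_nth u 0 = 0"
  shows "(1 - u) * fps_deriv (neg_power \<mu> u) = fps_const \<mu> * neg_power \<mu> u * fps_deriv u"
proof -
  define c where "c = (\<lambda>k. pochhammer \<mu> k / fact k)"
  define a where "a = Abs_fps c"
  have c: "(real n + 1) * c (Suc n) = (\<mu> + real n) * c n" for n
    by (simp add: c_def pochhammer_Suc divide_simps)
  have "(1 - fps_X) * fps_deriv a = fps_const \<mu> * a"
  proof (rule fps_ext)
    fix n
    show "fps_nth ((1 - fps_X) * fps_deriv a) n = fps_nth (fps_const \<mu> * a) n"
      using c[of n] by (cases n) (simp_all add: a_def left_diff_distrib algebra_simps)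
  qed
  then have "fps_compose ((1 - fps_X) * fps_deriv a) u = fps_compose (fps_const \<mu> * a) u" by simp
  then have "(1 - u) * fps_compose (fps_deriv a) u = fps_const \<mu> * fps_compose a u"
    using assms by (simp add: fps_compose_mult_distrib fps_compose_sub_distrib)
  then show ?thesis unfolding neg_power_def c_def[symmetric] a_def[symmetric] fps_compose_deriv[OF assms]
    by (metis mult.assoc)
qed

text \<open>
  The series \<open>u = 2tX - X\<^sup>2\<close>, for which \<open>1 - u = 1 - 2tX + X\<^sup>2\<close>.
\<close>

definition geg_kernel_arg :: "real \<Rightarrow> real fps" where
  "geg_kernel_arg t = fps_const (2 * t) * fps_X - fps_X\<^sup>2"

text \<open>
  Comparing coefficients in the differential equation of \<open>(1 - 2tX + X\<^sup>2) powr (- \<mu>)\<close> gives the three-term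
  recurrence that defines the polynomials.
\<close>

lemma geg_poly_generating:
  "neg_power \<mu> (geg_kernel_arg t) = Abs_fps (\<lambda>n. poly (geg_poly \<mu> n) t)"
proof -
  define g where "g = neg_power \<mu> (geg_kernel_arg t)"
  have u0: "fps_nth (geg_kernel_arg t) 0 = 0" by (simp add: geg_kernel_arg_def)
  have ode: "(1 - geg_kernel_arg t) * fps_deriv g = fps_const \<mu> * (fps_const (2 * t) * g - fps_const 2 * (fps_X * g))"
    using neg_power_deriv[OF u0, of \<mu>]
    by (simp add: g_def geg_kernel_arg_def fps_deriv_power power2_eq_square algebra_simps numeral_fps_const)
  have rec: "(real n + 1) * fps_nth g (Suc n) = 2 * (real n + \<mu>) * t * fps_nth g n
      - (real n + 2 * \<mu> - 1) * (if n = 0 then 0 else fps_nth g (n - 1))" for n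
  proof -
    have "fps_nth ((1 - geg_kernel_arg t) * fps_deriv g) n = (real n + 1) * fps_nth g (Suc n)
        - 2 * t * (real n * fps_nth g n) + (if n = 0 then 0 else (real n - 1) * fps_nth g (n - 1))"
      by (cases n; cases "n - 1")
         (auto simp: geg_kernel_arg_def left_diff_distrib mult.assoc fps_X_power_mult_nth)
    moreover have "fps_nth (fps_const \<mu> * (fps_const (2 * t) * g - fps_const 2 * (fps_X * g))) n =
        2 * \<mu> * t * fps_nth g n - 2 * \<mu> * (if n = 0 then 0 else fps_nth g (n - 1))"
      by (cases n) (auto simp: right_diff_distrib)
    ultimately have "(real n + 1) * fps_nth g (Suc n)
        - 2 * t * (real n * fps_nth g n) + (if n = 0 then 0 else (real n - 1) * fps_nth g (n - 1))
      = 2 * \<mu> * t * fps_nth g n - 2 * \<mu> * (if n = 0 then 0 else fps_nth g (n - 1))"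
      by (simp only: ode)
    then show ?thesis by (cases n) (simp_all add: algebra_simps)
  qed
  have "fps_nth g n = poly (geg_poly \<mu> n) t" for n
  proof (induction n rule: less_induct)
    case (less n)
    show ?case
    proof (cases n)
      case 0
      then show ?thesis by (simp add: g_def neg_power_def)
    next
      case (Suc m)
      have "(real m + 1) * fps_nth g (Suc m) = (real m + 1) * poly (geg_poly \<mu> (Suc m)) t"
        unfolding rec geg_poly_Suc using less Suc by (simp add: geg_prev_def)
      then show ?thesis using Suc by simp
    qed
  qed
  then show ?thesis by (simp add: g_def fps_eq_iff)
qed

lemma fps_const_sum: "fps_const (\<Sum>i\<in>I. f i) = (\<Sum>i\<in>I. fps_const (f i))"
  by (rule fps_ext) (simp add: fps_sum_nth)

lemma fps_const_prod: "fps_const (\<Prod>i\<in>I. f i) = (\<Prod>i\<in>I. fps_const (f i :: real))"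
  by (induction I rule: infinite_finite_induct) (simp_all flip: fps_const_mult)

text \<open>
  Because the weights \<open>y\<close> sum to 1, the series \<open>2 \<langle>x,y\<rangle> X - X\<^sup>2\<close> is the same convex combination of the
  series belonging to the points \<open>x\<^sub>i\<close>. The multinomial theorem then separates the powers of \<open>y\<close>, which are
  integrated later, from coefficients that depend on \<open>x\<close> only.
\<close>

lemma geg_poly_barycentric:
  assumes "finite I" "(\<Sum>i\<in>I. y i) = 1"
  shows "poly (geg_poly \<mu> n) (\<Sum>i\<in>I. x i * y i) =
    (\<Sum>k\<le>n. \<Sum>\<alpha>\<in>compositions I k. pochhammer \<mu> k * (\<Prod>i\<in>I. y i ^ \<alpha> i / fact (\<alpha> i))
       * fps_nth (\<Prod>i\<in>I. geg_kernel_arg (x i) ^ \<alpha> i) n)"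
proof -
  define u where "u = (\<lambda>i. geg_kernel_arg (x i))"
  define z where "z = (\<lambda>i. fps_const (y i) * u i)"
  have arg: "geg_kernel_arg (\<Sum>i\<in>I. x i * y i) = (\<Sum>i\<in>I. z i)"
  proof -
    have "(\<Sum>i\<in>I. z i) = (\<Sum>i\<in>I. fps_const (2 * (x i * y i)) * fps_X - fps_const (y i) * fps_X\<^sup>2)"
      unfolding z_def u_def geg_kernel_arg_def
      by (intro sum.cong refl) (simp add: right_diff_distrib mult.assoc[symmetric] mult.commute[of "y _"])
    also have "\<dots> = (\<Sum>i\<in>I. fps_const (2 * (x i * y i))) * fps_X - (\<Sum>i\<in>I. fps_const (y i)) * fps_X\<^sup>2"
      by (simp add: sum_subtractf sum_distrib_right)
    also have "(\<Sum>i\<in>I. fps_const (2 * (x i * y i))) = fps_const (2 * (\<Sum>i\<in>I. x i * y i))"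
      by (simp flip: fps_const_sum add: sum_distrib_left)
    also have "(\<Sum>i\<in>I. fps_const (y i)) = 1" using assms(2) by (simp flip: fps_const_sum)
    finally show ?thesis by (simp add: geg_kernel_arg_def)
  qed
  have pow: "fps_const (1 / fact k) * (\<Sum>i\<in>I. z i) ^ k =
      (\<Sum>\<alpha>\<in>compositions I k. fps_const (\<Prod>i\<in>I. y i ^ \<alpha> i / fact (\<alpha> i)) * (\<Prod>i\<in>I. u i ^ \<alpha> i))" for k
  proof -
    have "fps_const (1 / fact k) * (\<Sum>i\<in>I. z i) ^ k =
      (\<Sum>\<alpha>\<in>compositions I k. \<Prod>i\<in>I. fps_const (1 / fact (\<alpha> i)) * z i ^ \<alpha> i)"
      using arg_cong[OF multinomial_exponential[OF assms(1), of z], of "\<lambda>f. fps_nth f k"]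
      by (simp add: fps_nth_prod_compositions[OF assms(1)])
    also have "\<dots> = (\<Sum>\<alpha>\<in>compositions I k. fps_const (\<Prod>i\<in>I. y i ^ \<alpha> i / fact (\<alpha> i)) * (\<Prod>i\<in>I. u i ^ \<alpha> i))"
      unfolding fps_const_prod prod.distrib[symmetric] z_def
      by (intro sum.cong prod.cong refl) (simp add: power_mult_distrib fps_const_power mult.assoc[symmetric])
    finally show ?thesis .
  qed
  have "poly (geg_poly \<mu> n) (\<Sum>i\<in>I. x i * y i) = fps_nth (neg_power \<mu> (\<Sum>i\<in>I. z i)) n"
    unfolding arg[symmetric] geg_poly_generating by simp
  also have "\<dots> = (\<Sum>k\<le>n. pochhammer \<mu> k * fps_nth (fps_const (1 / fact k) * (\<Sum>i\<in>I. z i) ^ k) n)"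
    by (simp add: neg_power_def fps_compose_nth atLeast0AtMost)
  finally show ?thesis
    unfolding pow by (simp add: fps_sum_nth sum_distrib_left mult.assoc u_def)
qed

text \<open>
  The counterpart of \<open>geg_poly_barycentric\<close> with independent exponents. The two right-hand sides differ only
  in the factors \<open>pochhammer \<mu> k * \<Prod>\<^sub>i y\<^sub>i ^ \<alpha>\<^sub>i\<close> and \<open>\<Prod>\<^sub>i pochhammer (b i) (\<alpha> i)\<close>, and averaging over the Dirichlet
  distribution turns one into the other.
\<close>

lemma prod_neg_power_nth:
  assumes "finite I" "\<And>i. i \<in> I \<Longrightarrow> fps_nth (u i) 0 = 0"
  shows "fps_nth (\<Prod>i\<in>I. neg_power (b i) (u i)) n =
    (\<Sum>k\<le>n. \<Sum>\<alpha>\<in>compositions I k. (\<Prod>i\<in>I. pochhammer (b i) (\<alpha> i) / fact (\<alpha> i)) * fps_nth (\<Prod>i\<in>I. u i ^ \<alpha> i) n)"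
proof -
  define A where "A = (\<lambda>i. Abs_fps (\<lambda>k. fps_const (pochhammer (b i) k / fact k) * u i ^ k))"
  have "(\<Prod>i\<in>I. neg_power (b i) (u i)) = (\<Prod>i\<in>I. eval_outer_one (A i))"
    unfolding A_def using assms by (intro prod.cong neg_power_eq_eval_outer_one) auto
  also have "\<dots> = eval_outer_one (\<Prod>i\<in>I. A i)"
    using eval_outer_one_prod[of I A] assms neg_power_eq_eval_outer_one(1)[of "u _"] by (auto simp: A_def)
  finally have "fps_nth (\<Prod>i\<in>I. neg_power (b i) (u i)) n = (\<Sum>k\<le>n. fps_nth (fps_nth (\<Prod>i\<in>I. A i) k) n)"
    by (simp add: eval_outer_one_def)
  also have "\<dots> = (\<Sum>k\<le>n. \<Sum>\<alpha>\<in>compositions I k. fps_nth (\<Prod>i\<in>I. fps_const (pochhammer (b i) (\<alpha> i) / fact (\<alpha> i)) * u i ^ \<alpha> i) n)"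
    unfolding A_def fps_nth_prod_compositions[OF assms(1)] fps_sum_nth ..
  finally show ?thesis unfolding prod.distrib fps_const_prod[symmetric] by simp
qed

section \<open>The reproducing kernel of the product weight\<close>

definition zonal_prod :: "nat \<Rightarrow> (nat \<Rightarrow> real) \<Rightarrow> (nat \<Rightarrow> nat) \<Rightarrow> (nat \<Rightarrow> real) \<Rightarrow> real" where
  "zonal_prod d l \<alpha> x = (\<Prod>i=1..d. poly (zonal (l i) (\<alpha> i)) (x i))"

lemma finite_multi_indices [simp]: "finite (multi_indices d n)"
proof -
  have "finite ({1..d} \<rightarrow>\<^sub>E {0..n})" by (intro finite_PiE) auto
  then show ?thesis unfolding multi_indices_def by (rule rev_finite_subset) auto
qed

lemma multi_indicesI:
  assumes "\<beta> \<in> extensional {1..d}" "(\<Sum>i=1..d. \<beta> i) \<le> n"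
  shows "\<beta> \<in> multi_indices d n"
proof -
  have "\<beta> i \<le> n" if "i \<in> {1..d}" for i
    using member_le_sum[of i "{1..d}" \<beta>] that assms(2) by auto
  then show ?thesis using assms by (auto simp: multi_indices_def PiE_iff)
qed

lemma
  fixes f :: "'b \<Rightarrow> 'a \<Rightarrow> real"
  assumes "\<And>j. j \<in> J \<Longrightarrow> set_integrable M A (f j)"
  shows set_integrable_sum: "set_integrable M A (\<lambda>x. \<Sum>j\<in>J. f j x)"
    and set_integral_sum: "(LINT x:A|M. (\<Sum>j\<in>J. f j x)) = (\<Sum>j\<in>J. LINT x:A|M. f j x)"
  using assms unfolding set_integrable_def set_lebesgue_integral_def
  by (simp_all add: sum_distrib_left)

text \<open>
  The integrand is a product of functions of one coordinate each, so Fubini factors the integral. The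
  closed cube can be replaced by the open one because the weight vanishes at the endpoints:
  \<open>0 powr a = 0\<close> for every real \<open>a\<close>.
\<close>

lemma
  assumes "\<forall>i\<in>{1..d}. l i > - (1/2)"
  shows integrable_prod_weight:
      "set_integrable (\<Pi>\<^sub>M i\<in>{1..d}. lborel) ({1..d} \<rightarrow>\<^sub>E {-1..1})
         (\<lambda>x. (\<Prod>i=1..d. poly (p i) (x i)) * prod_weight d l x)" (is ?A)
    and integral_prod_weight:
      "(LINT x:({1..d} \<rightarrow>\<^sub>E {-1..1})|(\<Pi>\<^sub>M i\<in>{1..d}. lborel).
          (\<Prod>i=1..d. poly (p i) (x i)) * prod_weight d l x) = (\<Prod>i=1..d. geg_int (l i) (p i))" (is ?B)
proof -
  interpret product_sigma_finite "\<lambda>_::nat. lborel :: real measure"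
    by standard
  define f where "f = (\<lambda>i t. indicator {-1<..<1} t *\<^sub>R (geg_const (l i) * (poly (p i) t * geg_weight (l i) t)))"
  have f: "integrable lborel (f i)" if "i \<in> {1..d}" for i
    unfolding f_def
    using set_integrable_mult_right[OF set_integrable_poly_geg_weight[of "l i" "p i"], of "geg_const (l i)"] assms that
    unfolding set_integrable_def by blast
  have fi: "integral\<^sup>L lborel (f i) = geg_int (l i) (p i)" for i
    unfolding f_def geg_int_def set_lebesgue_integral_def
    by (simp add: mult.left_commute[of _ "geg_const (l i)"])
  have eq: "indicator ({1..d} \<rightarrow>\<^sub>E {-1..1}) x *\<^sub>R ((\<Prod>i=1..d. poly (p i) (x i)) * prod_weight d l x)
     = (\<Prod>i\<in>{1..d}. f i (x i))" if sp: "x \<in> space (\<Pi>\<^sub>M i\<in>{1..d}. lborel)" for x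
  proof (cases "x \<in> {1..d} \<rightarrow>\<^sub>E {-1..1}")
    case True
    have "f i (x i) = poly (p i) (x i) * (geg_const (l i) * geg_weight (l i) (x i))" if "i \<in> {1..d}" for i
    proof (cases "x i \<in> {-1<..<1}")
      case False
      then have "x i = 1 \<or> x i = -1" using True that by (force simp: PiE_iff)
      then show ?thesis by (auto simp: f_def geg_weight_def)
    qed (simp add: f_def)
    then show ?thesis using True by (simp add: prod_weight_def prod.distrib [symmetric])
  next
    case False
    then obtain i where i: "i \<in> {1..d}" "x i \<notin> {-1..1}" using sp by (auto simp: space_PiM PiE_iff)
    then have "f i (x i) = 0" by (auto simp: f_def)
    then have "(\<Prod>i\<in>{1..d}. f i (x i)) = 0" using i by (metis finite_atLeastAtMost prod_zero_iff)
    then show ?thesis using False by simp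
  qed
  show ?A unfolding set_integrable_def
    using product_integrable_prod[of "{1..d}" f, OF _ f]
    by (subst Bochner_Integration.integrable_cong[OF refl eq]) auto
  show ?B unfolding set_lebesgue_integral_def
    using product_integral_prod[of "{1..d}" f, OF _ f]
    by (subst Bochner_Integration.integral_cong[OF refl eq]) (auto simp: fi)
qed

lemma integrable_poly_funs_mult:
  assumes l: "\<forall>i\<in>{1..d}. l i > - (1/2)" and "f \<in> poly_funs d n" "g \<in> poly_funs d m"
  shows "set_integrable (\<Pi>\<^sub>M i\<in>{1..d}. lborel) ({1..d} \<rightarrow>\<^sub>E {-1..1}) (\<lambda>x. f x * g x * prod_weight d l x)"
proof -
  obtain c where f: "f = (\<lambda>x. \<Sum>\<alpha>\<in>multi_indices d n. c \<alpha> * (\<Prod>i=1..d. x i ^ \<alpha> i))"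
    using assms by (auto simp: poly_funs_def)
  obtain e where g: "g = (\<lambda>x. \<Sum>\<alpha>\<in>multi_indices d m. e \<alpha> * (\<Prod>i=1..d. x i ^ \<alpha> i))"
    using assms by (auto simp: poly_funs_def)
  have eq: "f x * g x * prod_weight d l x = (\<Sum>\<alpha>\<in>multi_indices d n. \<Sum>\<beta>\<in>multi_indices d m.
      (c \<alpha> * e \<beta>) * ((\<Prod>i=1..d. poly (monom 1 (\<alpha> i + \<beta> i)) (x i)) * prod_weight d l x))" for x
    unfolding f g sum_product sum_distrib_right
    by (intro sum.cong refl) (simp add: sum_distrib_left poly_monom power_add prod.distrib mult_ac)
  show ?thesis unfolding eq
    by (intro set_integrable_sum set_integrable_mult_right integrable_prod_weight l)
qed

lemma cube_inner_commute: "cube_inner d l f g = cube_inner d l g f"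
  by (simp add: cube_inner_def mult.commute)

lemma cube_inner_sum:
  assumes "\<forall>i\<in>{1..d}. l i > - (1/2)" "\<And>j. j \<in> J \<Longrightarrow> f j \<in> poly_funs d n" "g \<in> poly_funs d m" "finite J"
  shows "cube_inner d l (\<lambda>x. \<Sum>j\<in>J. a j * f j x) g = (\<Sum>j\<in>J. a j * cube_inner d l (f j) g)"
proof -
  have "cube_inner d l (\<lambda>x. \<Sum>j\<in>J. a j * f j x) g =
     (LINT x:({1..d} \<rightarrow>\<^sub>E {-1..1})|(\<Pi>\<^sub>M i\<in>{1..d}. lborel). (\<Sum>j\<in>J. a j * (f j x * g x * prod_weight d l x)))"
    unfolding cube_inner_def by (simp add: sum_distrib_right mult.assoc)
  also have "\<dots> = (\<Sum>j\<in>J. (LINT x:({1..d} \<rightarrow>\<^sub>E {-1..1})|(\<Pi>\<^sub>M i\<in>{1..d}. lborel). a j * (f j x * g x * prod_weight d l x)))"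
    using integrable_poly_funs_mult[OF assms(1) assms(2) assms(3)] assms(4)
    by (intro set_integral_sum) auto
  also have "\<dots> = (\<Sum>j\<in>J. a j * cube_inner d l (f j) g)"
    unfolding cube_inner_def by simp
  finally show ?thesis .
qed

text \<open>
  Products of functions inherit a triangular change of basis. This serves for both directions, from
  monomials to products of zonal polynomials and back.
\<close>

lemma prod_triangular_expansion:
  fixes u v :: "nat \<Rightarrow> nat \<Rightarrow> real \<Rightarrow> real"
  assumes u: "\<And>i k t. i \<in> {1..d} \<Longrightarrow> u i k t = (\<Sum>j\<le>k. a i k j * v i j t)"
    and n: "(\<Sum>i=1..d. \<alpha> i) \<le> n"
  shows "\<exists>e. \<forall>x. (\<Prod>i=1..d. u i (\<alpha> i) (x i)) = (\<Sum>\<beta>\<in>multi_indices d n. e \<beta> * (\<Prod>i=1..d. v i (\<beta> i) (x i)))"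
proof -
  define P where "P = ({1..d} \<rightarrow>\<^sub>E UNIV) \<inter> {\<beta>. \<forall>i\<in>{1..d}. \<beta> i \<le> \<alpha> i}"
  have P: "P = PiE {1..d} (\<lambda>i. {..\<alpha> i})" by (auto simp: P_def PiE_iff)
  have sub: "P \<subseteq> multi_indices d n"
  proof
    fix \<beta> assume b: "\<beta> \<in> P"
    then have "(\<Sum>i=1..d. \<beta> i) \<le> (\<Sum>i=1..d. \<alpha> i)" by (intro sum_mono) (auto simp: P_def)
    then show "\<beta> \<in> multi_indices d n" using b n by (intro multi_indicesI) (auto simp: P_def PiE_iff)
  qed
  define e where "e = (\<lambda>\<beta>. if \<beta> \<in> P then (\<Prod>i=1..d. a i (\<alpha> i) (\<beta> i)) else 0)"
  have "(\<Prod>i=1..d. u i (\<alpha> i) (x i)) = (\<Sum>\<beta>\<in>multi_indices d n. e \<beta> * (\<Prod>i=1..d. v i (\<beta> i) (x i)))" for x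
  proof -
    have "(\<Prod>i=1..d. u i (\<alpha> i) (x i)) = (\<Prod>i=1..d. \<Sum>j\<in>{..\<alpha> i}. a i (\<alpha> i) j * v i j (x i))"
      using u by (intro prod.cong) auto
    also have "\<dots> = (\<Sum>\<beta>\<in>P. \<Prod>i=1..d. a i (\<alpha> i) (\<beta> i) * v i (\<beta> i) (x i))"
      unfolding P by (intro prod_sum_PiE) auto
    also have "\<dots> = (\<Sum>\<beta>\<in>P. e \<beta> * (\<Prod>i=1..d. v i (\<beta> i) (x i)))"
      by (intro sum.cong) (auto simp: e_def prod.distrib)
    also have "\<dots> = (\<Sum>\<beta>\<in>multi_indices d n. e \<beta> * (\<Prod>i=1..d. v i (\<beta> i) (x i)))"
      by (intro sum.mono_neutral_left sub) (auto simp: e_def)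
    finally show ?thesis .
  qed
  then show ?thesis by blast
qed

lemma zonal_prod_in_poly_funs:
  assumes l: "\<forall>i\<in>{1..d}. l i > - (1/2)" and "(\<Sum>i=1..d. \<alpha> i) \<le> n"
  shows "zonal_prod d l \<alpha> \<in> poly_funs d n"
proof -
  have "poly (zonal (l i) k) t = (\<Sum>j\<le>k. coeff (zonal (l i) k) j * t ^ j)" if "i \<in> {1..d}" for i k t
    using that l by (simp add: poly_altdef degree_zonal)
  from prod_triangular_expansion[where u = "\<lambda>i k. poly (zonal (l i) k)" and v = "\<lambda>i j t. t ^ j", OF this assms(2)]
  show ?thesis by (auto simp: poly_funs_def zonal_prod_def fun_eq_iff)
qed

lemma poly_funs_zonal_prod_expansion:
  assumes l: "\<forall>i\<in>{1..d}. l i > - (1/2)" and f: "f \<in> poly_funs d n"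
  shows "\<exists>e. f = (\<lambda>x. \<Sum>\<beta>\<in>multi_indices d n. e \<beta> * zonal_prod d l \<beta> x)"
proof -
  obtain c where c: "f = (\<lambda>x. \<Sum>\<alpha>\<in>multi_indices d n. c \<alpha> * (\<Prod>i=1..d. x i ^ \<alpha> i))"
    using assms by (auto simp: poly_funs_def)
  have "\<exists>a. \<forall>t. t ^ k = (\<Sum>j\<le>k. a j * poly (zonal (l i) j) t)" if i: "i \<in> {1..d}" for i k
  proof -
    obtain a where "monom 1 k = (\<Sum>j\<le>k. smult (a j) (zonal (l i) j))"
      using zonal_span[OF bspec[OF l i] degree_monom_le[of 1 k]] by blast
    then have "poly (monom 1 k) t = (\<Sum>j\<le>k. a j * poly (zonal (l i) j) t)" for t
      by (simp add: poly_sum)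
    then show ?thesis by (auto simp: poly_monom)
  qed
  then obtain a where a: "\<And>i k t. i \<in> {1..d} \<Longrightarrow> t ^ k = (\<Sum>j\<le>k. a i k j * poly (zonal (l i) j) t)"
    by metis
  have "\<exists>e. \<forall>x. (\<Prod>i=1..d. x i ^ \<alpha> i) = (\<Sum>\<beta>\<in>multi_indices d n. e \<beta> * zonal_prod d l \<beta> x)"
    if "\<alpha> \<in> multi_indices d n" for \<alpha>
    unfolding zonal_prod_def
    by (rule prod_triangular_expansion[where u = "\<lambda>i k t. t ^ k"])
       (use a that in \<open>auto simp: multi_indices_def\<close>)
  then obtain e where e: "\<And>\<alpha> x. \<alpha> \<in> multi_indices d n \<Longrightarrow>
      (\<Prod>i=1..d. x i ^ \<alpha> i) = (\<Sum>\<beta>\<in>multi_indices d n. e \<alpha> \<beta> * zonal_prod d l \<beta> x)" by metis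
  have "f x = (\<Sum>\<beta>\<in>multi_indices d n. (\<Sum>\<alpha>\<in>multi_indices d n. c \<alpha> * e \<alpha> \<beta>) * zonal_prod d l \<beta> x)" for x
  proof -
    have "f x = (\<Sum>\<alpha>\<in>multi_indices d n. \<Sum>\<beta>\<in>multi_indices d n. c \<alpha> * (e \<alpha> \<beta> * zonal_prod d l \<beta> x))"
      unfolding c sum_distrib_left[symmetric] by (intro sum.cong refl) (simp only: e)
    also have "\<dots> = (\<Sum>\<beta>\<in>multi_indices d n. \<Sum>\<alpha>\<in>multi_indices d n. c \<alpha> * (e \<alpha> \<beta> * zonal_prod d l \<beta> x))"
      by (rule sum.swap)
    finally show ?thesis by (simp add: sum_distrib_right mult.assoc)
  qed
  then show ?thesis by (intro exI[of _ "\<lambda>\<beta>. \<Sum>\<alpha>\<in>multi_indices d n. c \<alpha> * e \<alpha> \<beta>"] ext)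
qed

lemma cube_inner_zonal_prod:
  assumes l: "\<forall>i\<in>{1..d}. l i > - (1/2)" and "\<alpha> \<in> extensional {1..d}" "\<beta> \<in> extensional {1..d}"
  shows "cube_inner d l (zonal_prod d l \<alpha>) (zonal_prod d l \<beta>) =
    (if \<alpha> = \<beta> then zonal_prod d l \<alpha> (\<lambda>_. 1) else 0)"
proof -
  have "cube_inner d l (zonal_prod d l \<alpha>) (zonal_prod d l \<beta>) =
     (\<Prod>i=1..d. geg_int (l i) (zonal (l i) (\<alpha> i) * zonal (l i) (\<beta> i)))"
    unfolding integral_prod_weight[OF l, symmetric] cube_inner_def zonal_prod_def
    by (simp add: prod.distrib)
  also have "\<dots> = (\<Prod>i=1..d. if \<alpha> i = \<beta> i then poly (zonal (l i) (\<alpha> i)) 1 else 0)"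
    using l by (intro prod.cong) (auto simp: geg_int_zonal_zonal)
  also have "\<dots> = (if \<alpha> = \<beta> then zonal_prod d l \<alpha> (\<lambda>_. 1) else 0)"
  proof (cases "\<alpha> = \<beta>")
    case False
    then obtain i where "i \<in> {1..d}" "\<alpha> i \<noteq> \<beta> i" using assms(2,3) by (metis extensionalityI)
    then show ?thesis using False by (auto simp del: atLeastAtMost_iff intro!: prod_zero bexI[of _ i])
  qed (simp add: zonal_prod_def)
  finally show ?thesis .
qed

lemma zonal_prod_at_1_pos:
  "\<forall>i\<in>{1..d}. l i > - (1/2) \<Longrightarrow> zonal_prod d l \<alpha> (\<lambda>_. 1) > 0"
  unfolding zonal_prod_def by (intro prod_pos) (auto simp: zonal_at_1_pos)

lemma compositions_eq: "compositions {1..d} n = {\<alpha> \<in> multi_indices d n. (\<Sum>i=1..d. \<alpha> i) = n}"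
  using multi_indicesI[of _ d n] by (auto simp: compositions_def multi_indices_def PiE_iff)

text \<open>
  The squared norm of a product of zonal polynomials is its value at the corner \<open>(1, \<dots>, 1)\<close>, hence the
  normalisation. An orthogonal polynomial of degree \<open>n\<close> expands in products of total degree at most \<open>n\<close>,
  and its coefficients at lower total degrees vanish since they are inner products with polynomials of
  lower degree.
\<close>

lemma orthonormal_basis_zonal_prod:
  assumes l: "\<forall>i\<in>{1..d}. l i > - (1/2)"
  defines "h \<equiv> \<lambda>\<alpha>. zonal_prod d l \<alpha> (\<lambda>_. 1)"
  defines "b \<equiv> \<lambda>\<alpha> x. 1 / sqrt (h \<alpha>) * zonal_prod d l \<alpha> x"
  shows "inj_on b (compositions {1..d} n)" "orthonormal_basis d l n (b ` compositions {1..d} n)"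
proof -
  let ?C = "compositions {1..d} n"
  have h: "h \<alpha> > 0" for \<alpha> using zonal_prod_at_1_pos[OF l] by (simp add: h_def)
  have h_eq: "zonal_prod d l \<alpha> (\<lambda>_. 1) = h \<alpha>" for \<alpha> by (simp add: h_def)
  have ext: "\<alpha> \<in> extensional {1..d}" if "\<alpha> \<in> multi_indices d m" for \<alpha> m
    using that by (auto simp: multi_indices_def PiE_iff)
  have Cext: "\<alpha> \<in> extensional {1..d}" if "\<alpha> \<in> ?C" for \<alpha>
    using that by (simp add: compositions_def)
  have Csub: "?C \<subseteq> multi_indices d n" unfolding compositions_eq by blast
  then have fin: "finite ?C" by (rule finite_subset) simp
  have inner_scale: "cube_inner d l (\<lambda>x. a * f x) (\<lambda>x. c * g x) = a * c * cube_inner d l f g" for a c f g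
    unfolding cube_inner_def by (simp flip: set_integral_mult_right add: mult_ac)
  have orth: "cube_inner d l (b \<alpha>) (b \<beta>) = (if \<alpha> = \<beta> then 1 else 0)" if "\<alpha> \<in> ?C" "\<beta> \<in> ?C" for \<alpha> \<beta>
    using h[of \<alpha>] that unfolding b_def inner_scale
    by (auto simp: cube_inner_zonal_prod[OF l Cext Cext] h_eq)
  show inj: "inj_on b ?C"
    by (rule inj_onI) (metis orth zero_neq_one)
  have "b \<alpha> \<in> orth_polys d l n" if a: "\<alpha> \<in> ?C" for \<alpha>
  proof -
    have "zonal_prod d l \<alpha> \<in> poly_funs d n"
      using a by (intro zonal_prod_in_poly_funs l) (auto simp: compositions_def)
    then obtain c where "zonal_prod d l \<alpha> = (\<lambda>x. \<Sum>\<alpha>\<in>multi_indices d n. c \<alpha> * (\<Prod>i=1..d. x i ^ \<alpha> i))"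
      by (auto simp: poly_funs_def)
    then have "b \<alpha> = (\<lambda>x. \<Sum>\<gamma>\<in>multi_indices d n. (1 / sqrt (h \<alpha>) * c \<gamma>) * (\<Prod>i=1..d. x i ^ \<gamma> i))"
      unfolding b_def by (simp add: sum_divide_distrib)
    then have bp: "b \<alpha> \<in> poly_funs d n"
      unfolding poly_funs_def mem_Collect_eq by (rule exI[of _ "\<lambda>\<gamma>. 1 / sqrt (h \<alpha>) * c \<gamma>"])
    have ort: "cube_inner d l (b \<alpha>) q = 0" if m: "m < n" and q: "q \<in> poly_funs d m" for m q
    proof -
      obtain e where e: "q = (\<lambda>x. \<Sum>\<beta>\<in>multi_indices d m. e \<beta> * zonal_prod d l \<beta> x)"
        using poly_funs_zonal_prod_expansion[OF l q] by blast
      have "cube_inner d l q (b \<alpha>) = (\<Sum>\<beta>\<in>multi_indices d m. e \<beta> * cube_inner d l (zonal_prod d l \<beta>) (b \<alpha>))"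
        unfolding e by (rule cube_inner_sum[OF l _ bp finite_multi_indices]) (auto intro!: zonal_prod_in_poly_funs l simp: multi_indices_def)
      also have "\<dots> = (\<Sum>\<beta>\<in>multi_indices d m. 0)"
      proof (intro sum.cong refl)
        fix \<beta> assume \<beta>: "\<beta> \<in> multi_indices d m"
        then have "\<beta> \<noteq> \<alpha>" using a m by (auto simp: multi_indices_def compositions_def)
        then show "e \<beta> * cube_inner d l (zonal_prod d l \<beta>) (b \<alpha>) = 0"
          using inner_scale[of 1 "zonal_prod d l \<beta>" "1 / sqrt (h \<alpha>)" "zonal_prod d l \<alpha>"]
            cube_inner_zonal_prod[OF l ext[OF \<beta>] Cext[OF a]] by (simp add: b_def)
      qed
      finally show ?thesis by (simp add: cube_inner_commute)
    qed
    \<comment> \<open>A lower degree would make the polynomial orthogonal to itself, contradicting its norm.\<close>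
    have "b \<alpha> \<notin> poly_funs d m" if "m < n" for m
      using ort[OF that] orth[OF a a] by fastforce
    then show ?thesis using bp ort by (auto simp: orth_polys_def)
  qed
  moreover have "\<exists>a. f = (\<lambda>x. \<Sum>p\<in>b ` ?C. a p * p x)" if f: "f \<in> orth_polys d l n" for f
  proof -
    obtain e where e: "f = (\<lambda>x. \<Sum>\<beta>\<in>multi_indices d n. e \<beta> * zonal_prod d l \<beta> x)"
      using poly_funs_zonal_prod_expansion[OF l, of f n] f by (auto simp: orth_polys_def)
    have e0: "e \<gamma> = 0" if g: "\<gamma> \<in> multi_indices d n - ?C" for \<gamma>
    proof -
      have g': "(\<Sum>i=1..d. \<gamma> i) < n" "\<gamma> \<in> multi_indices d n"
        using g by (auto simp: multi_indices_def compositions_def PiE_iff)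
      have gp: "zonal_prod d l \<gamma> \<in> poly_funs d (\<Sum>i=1..d. \<gamma> i)"
        by (intro zonal_prod_in_poly_funs l) auto
      then have "0 = cube_inner d l f (zonal_prod d l \<gamma>)"
        using f g' by (auto simp: orth_polys_def)
      also have "\<dots> = (\<Sum>\<beta>\<in>multi_indices d n. e \<beta> * cube_inner d l (zonal_prod d l \<beta>) (zonal_prod d l \<gamma>))"
        unfolding e by (rule cube_inner_sum[OF l _ gp finite_multi_indices]) (auto intro!: zonal_prod_in_poly_funs l simp: multi_indices_def)
      also have "\<dots> = (\<Sum>\<beta>\<in>multi_indices d n. if \<beta> = \<gamma> then e \<gamma> * h \<gamma> else 0)"
        by (intro sum.cong) (auto simp: cube_inner_zonal_prod[OF l ext ext[OF g'(2)]] h_def)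
      finally show ?thesis using g' h[of \<gamma>] by simp
    qed
    have "f = (\<lambda>x. \<Sum>p\<in>b ` ?C. (e (inv_into ?C b p) * sqrt (h (inv_into ?C b p))) * p x)"
    proof
      fix x
      have "f x = (\<Sum>\<beta>\<in>?C. e \<beta> * zonal_prod d l \<beta> x)"
        unfolding e by (intro sum.mono_neutral_right) (use e0 Csub in auto)
      also have "\<dots> = (\<Sum>\<beta>\<in>?C. e \<beta> * sqrt (h \<beta>) * b \<beta> x)"
        using h by (intro sum.cong) (auto simp: b_def less_imp_neq[OF h, symmetric])
      finally show "f x = (\<Sum>p\<in>b ` ?C. (e (inv_into ?C b p) * sqrt (h (inv_into ?C b p))) * p x)"
        using inj by (simp add: sum.reindex)
    qed
    then show ?thesis by (intro exI[of _ "\<lambda>p. e (inv_into ?C b p) * sqrt (h (inv_into ?C b p))"])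
  qed
  ultimately show "orthonormal_basis d l n (b ` ?C)"
    unfolding orthonormal_basis_def using fin orth inj by (auto simp: inj_on_eq_iff)
qed

lemma orthonormal_basis_expansion:
  assumes l: "\<forall>i\<in>{1..d}. l i > - (1/2)" and B: "orthonormal_basis d l n B" and f: "f \<in> orth_polys d l n"
  shows "f x = (\<Sum>p\<in>B. cube_inner d l f p * p x)"
proof -
  obtain a where a: "f = (\<lambda>x. \<Sum>p\<in>B. a p * p x)" using B f by (auto simp: orthonormal_basis_def)
  have fin: "finite B" and sub: "B \<subseteq> poly_funs d n" using B by (auto simp: orthonormal_basis_def orth_polys_def)
  have "cube_inner d l f q = a q" if q: "q \<in> B" for q
  proof -
    have "cube_inner d l f q = (\<Sum>p\<in>B. a p * cube_inner d l p q)"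
      unfolding a by (rule cube_inner_sum[OF l, where m = n and n = n]) (use sub q fin in auto)
    also have "\<dots> = (\<Sum>p\<in>B. if p = q then a q else 0)"
      using B q by (intro sum.cong) (auto simp: orthonormal_basis_def)
    finally show ?thesis using q fin by simp
  qed
  then have "(\<Sum>p\<in>B. cube_inner d l f p * p x) = (\<Sum>p\<in>B. a p * p x)" by (intro sum.cong) auto
  then show ?thesis by (simp add: a)
qed

text \<open>
  Expanding each element of one basis in the other and exchanging the two sums shows that the kernel does
  not depend on the basis.
\<close>

lemma orthonormal_basis_kernel_unique:
  assumes l: "\<forall>i\<in>{1..d}. l i > - (1/2)"
    and B: "orthonormal_basis d l n B" and C: "orthonormal_basis d l n C"
  shows "(\<Sum>p\<in>B. p x * p y) = (\<Sum>q\<in>C. q x * q y)"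
proof -
  have sub: "B \<subseteq> orth_polys d l n" "C \<subseteq> orth_polys d l n"
    using B C by (auto simp: orthonormal_basis_def)
  have "(\<Sum>p\<in>B. p x * p y) = (\<Sum>p\<in>B. (\<Sum>q\<in>C. cube_inner d l p q * q x) * p y)"
  proof (intro sum.cong refl)
    fix p assume "p \<in> B"
    then have "p \<in> orth_polys d l n" using sub by auto
    from orthonormal_basis_expansion[OF l C this, of x]
    show "p x * p y = (\<Sum>q\<in>C. cube_inner d l p q * q x) * p y" by simp
  qed
  also have "\<dots> = (\<Sum>q\<in>C. \<Sum>p\<in>B. cube_inner d l p q * q x * p y)"
    unfolding sum_distrib_right by (rule sum.swap)
  also have "\<dots> = (\<Sum>q\<in>C. q x * (\<Sum>p\<in>B. cube_inner d l q p * p y))"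
    by (simp add: sum_distrib_left cube_inner_commute[of d l] mult_ac)
  also have "\<dots> = (\<Sum>q\<in>C. q x * q y)"
  proof (intro sum.cong refl)
    fix q assume "q \<in> C"
    then have "q \<in> orth_polys d l n" using sub by auto
    from orthonormal_basis_expansion[OF l B this, of y]
    show "q x * (\<Sum>p\<in>B. cube_inner d l q p * p y) = q x * q y" by simp
  qed
  finally show ?thesis .
qed

text \<open>
  At the corner the normalising factor of each basis element cancels against its value there.
\<close>

lemma repr_kernel_one:
  assumes l: "\<forall>i\<in>{1..d}. l i > - (1/2)"
  shows "repr_kernel d l n x (\<lambda>_. 1) = (\<Sum>\<alpha>\<in>compositions {1..d} n. zonal_prod d l \<alpha> x)"
proof -
  define h where "h = (\<lambda>\<alpha>. zonal_prod d l \<alpha> (\<lambda>_. 1))"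
  define b where "b = (\<lambda>\<alpha> x. 1 / sqrt (h \<alpha>) * zonal_prod d l \<alpha> x)"
  define s where "s = (\<Sum>\<alpha>\<in>compositions {1..d} n. zonal_prod d l \<alpha> x)"
  have basis: "inj_on b (compositions {1..d} n)" "orthonormal_basis d l n (b ` compositions {1..d} n)"
    using orthonormal_basis_zonal_prod[OF l, of n] unfolding b_def h_def by blast+
  have h: "h \<alpha> > 0" for \<alpha> using zonal_prod_at_1_pos[OF l] by (simp add: h_def)
  have h_eq: "zonal_prod d l \<alpha> (\<lambda>_. 1) = h \<alpha>" for \<alpha> by (simp add: h_def)
  have "(\<Sum>p\<in>b ` compositions {1..d} n. p x * p (\<lambda>_. 1)) = (\<Sum>\<alpha>\<in>compositions {1..d} n. b \<alpha> x * b \<alpha> (\<lambda>_. 1))"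
    unfolding sum.reindex[OF basis(1)] by simp
  also have "\<dots> = s"
    unfolding s_def b_def
  proof (intro sum.cong refl)
    fix \<alpha>
    show "1 / sqrt (h \<alpha>) * zonal_prod d l \<alpha> x * (1 / sqrt (h \<alpha>) * zonal_prod d l \<alpha> (\<lambda>_. 1)) = zonal_prod d l \<alpha> x"
      using h[of \<alpha>] by (simp add: h_eq)
  qed
  finally have *: "(\<Sum>p\<in>b ` compositions {1..d} n. p x * p (\<lambda>_. 1)) = s" .
  show ?thesis unfolding repr_kernel_def s_def[symmetric]
  proof (rule the_equality)
    show "\<forall>B. orthonormal_basis d l n B \<longrightarrow> s = (\<Sum>p\<in>B. p x * p (\<lambda>_. 1))"
      using orthonormal_basis_kernel_unique[OF l basis(2), of _ x "\<lambda>_. 1"] unfolding * by blast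
  qed (use basis(2) * in auto)
qed

section \<open>Dirichlet integrals over the simplex\<close>

lemma nn_integral_Beta_scaled:
  fixes a b s :: real
  assumes "a > 0" "b > 0" "s > 0"
  shows "(\<integral>\<^sup>+ t. indicator {0<..<s} t * ennreal (t powr (a - 1) * (s - t) powr (b - 1)) \<partial>lborel)
     = ennreal (s powr (a + b - 1) * Beta a b)"
proof -
  have "(\<integral>\<^sup>+ t. indicator {0<..<s} t * ennreal (t powr (a - 1) * (s - t) powr (b - 1)) \<partial>lborel)
    = s * (\<integral>\<^sup>+ t. indicator {0<..<s} (0 + s * t) * ennreal ((0 + s * t) powr (a - 1) * (s - (0 + s * t)) powr (b - 1)) \<partial>lborel)"
    using assms by (subst nn_integral_real_affine[where c = s and t = 0]) auto
  also have "\<dots> = s * (\<integral>\<^sup>+ t. ennreal (s powr (a + b - 2)) * (indicator {0..1} t * ennreal (t powr (a - 1) * (1 - t) powr (b - 1))) \<partial>lborel)"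
  proof -
    have "indicator {0<..<s} (0 + s * t) * ennreal ((0 + s * t) powr (a - 1) * (s - (0 + s * t)) powr (b - 1))
      = ennreal (s powr (a + b - 2)) * (indicator {0..1} t * ennreal (t powr (a - 1) * (1 - t) powr (b - 1)))" for t
    proof (cases "0 < t \<and> t < 1")
      case True
      have "s - s * t = s * (1 - t)" by (simp add: algebra_simps)
      moreover have "s powr (a + b - 2) = s powr (a - 1) * s powr (b - 1)"
        by (simp flip: powr_add)
      ultimately have "(s * t) powr (a - 1) * (s - s * t) powr (b - 1)
          = s powr (a + b - 2) * (t powr (a - 1) * (1 - t) powr (b - 1))"
        using True assms by (simp add: powr_mult)
      then show ?thesis using True assms by (simp add: ennreal_mult')
    next
      case False
      then have "indicator {0..1} t * ennreal (t powr (a - 1) * (1 - t) powr (b - 1)) = 0"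
        by (cases "t = 0"; cases "t = 1") auto
      moreover have "s * t \<notin> {0<..<s}"
        using False assms by (auto simp: zero_less_mult_iff)
      ultimately show ?thesis by simp
    qed
    then show ?thesis by (simp only:)
  qed
  also have "\<dots> = s * (ennreal (s powr (a + b - 2)) * ennreal (Beta a b))"
  proof -
    have "(\<integral>\<^sup>+ t. indicator {0..1} t * ennreal (t powr (a - 1) * (1 - t) powr (b - 1)) \<partial>lborel) = Beta a b"
      using nn_integral_has_integral_lebesgue[OF _ has_integral_Beta_real[OF assms(1,2)]]
      by (simp add: ennreal_mult' ennreal_indicator)
    then show ?thesis by (simp add: nn_integral_cmult)
  qed
  also have "\<dots> = ennreal (s powr (a + b - 1) * Beta a b)"
  proof -
    have "s * s powr (a + b - 2) = s powr (a + b - 1)"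
      using assms powr_add[of s 1 "a + b - 2"] by simp
    moreover have "Beta a b \<ge> 0" using assms by (simp add: Beta_def Gamma_real_nonneg)
    ultimately show ?thesis using assms by (simp add: ennreal_mult'[symmetric] mult.assoc[symmetric])
  qed
  finally show ?thesis .
qed

text \<open>
  Dirichlet's formula over the scaled simplex \<open>\<Sum>\<^sub>i y\<^sub>i < s\<close>. The free scale \<open>s\<close> is what makes the induction work:
  integrating out all coordinates but one leaves a Beta integral in which the inner scale is \<open>s\<close> minus
  the remaining coordinate. Nonnegative integrals avoid any integrability question on the way. Strict
  inequalities keep the inner scale positive.
\<close>

lemma nn_integral_Dirichlet_scaled:
  fixes a :: "nat \<Rightarrow> real"
  assumes "finite J" "\<And>i. i \<in> J \<Longrightarrow> a i > 0" "b > 0" "s > 0"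
  shows "(\<integral>\<^sup>+ y. (if (\<forall>i\<in>J. 0 < y i) \<and> (\<Sum>i\<in>J. y i) < s
        then ennreal ((\<Prod>i\<in>J. y i powr (a i - 1)) * (s - (\<Sum>i\<in>J. y i)) powr (b - 1)) else 0) \<partial>(\<Pi>\<^sub>M i\<in>J. lborel))
     = ennreal (s powr ((\<Sum>i\<in>J. a i) + b - 1) * ((\<Prod>i\<in>J. Gamma (a i)) * Gamma b / Gamma ((\<Sum>i\<in>J. a i) + b)))"
  using assms
proof (induction J arbitrary: s)
  case empty
  then show ?case by (auto simp: PiM_empty Gamma_eq_zero_iff dest: nonpos_Ints_nonpos)
next
  case (insert j J)
  interpret product_sigma_finite "\<lambda>_::nat. lborel :: real measure" by standard
  note [simp] = insert(1)
  define A where "A = (\<Sum>i\<in>J. a i) + b"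
  have "(\<Sum>i\<in>J. a i) \<ge> 0" using insert.prems(1) by (intro sum_nonneg) (simp add: less_imp_le)
  then have A: "A > 0" using insert.prems(2) by (simp add: A_def)
  define C where "C = (\<Prod>i\<in>J. Gamma (a i)) * Gamma b / Gamma A"
  have C: "C \<ge> 0" unfolding C_def using insert.prems A
    by (intro divide_nonneg_nonneg mult_nonneg_nonneg prod_nonneg Gamma_real_nonneg) (auto intro: less_imp_le)
  have j: "a j > 0" using insert by auto
  define g where "g = (\<lambda>s y. (if (\<forall>i\<in>J. 0 < y i) \<and> (\<Sum>i\<in>J. y i) < s
        then ennreal ((\<Prod>i\<in>J. y i powr (a i - 1)) * (s - (\<Sum>i\<in>J. y i)) powr (b - 1)) else 0))"
  have IH: "(\<integral>\<^sup>+ y. g s y \<partial>(\<Pi>\<^sub>M i\<in>J. lborel)) = ennreal (s powr (A - 1) * C)" if "s > 0" for s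
    using insert.IH[OF _ insert.prems(2) that] insert.prems(1) unfolding g_def A_def C_def by auto
  have split: "(if (\<forall>i\<in>insert j J. 0 < (y(j := t)) i) \<and> (\<Sum>i\<in>insert j J. (y(j := t)) i) < s
        then ennreal ((\<Prod>i\<in>insert j J. (y(j := t)) i powr (a i - 1)) * (s - (\<Sum>i\<in>insert j J. (y(j := t)) i)) powr (b - 1)) else 0)
      = indicator {0<..<s} t * ennreal (t powr (a j - 1)) * g (s - t) y" for y t
  proof -
    have eqs: "(\<Sum>i\<in>J. (y(j := t)) i) = (\<Sum>i\<in>J. y i)"
       "(\<Prod>i\<in>J. (y(j := t)) i powr (a i - 1)) = (\<Prod>i\<in>J. y i powr (a i - 1))"
       "(\<forall>i\<in>J. 0 < (y(j := t)) i) \<longleftrightarrow> (\<forall>i\<in>J. 0 < y i)"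
      using insert(2) by (auto intro!: sum.cong prod.cong)
    have pos: "(\<Sum>i\<in>J. y i) \<ge> 0" if "\<forall>i\<in>J. 0 < y i" using that by (intro sum_nonneg) (simp add: less_imp_le)
    have "t < s" if "\<forall>i\<in>J. 0 < y i" "t + (\<Sum>i\<in>J. y i) < s" using pos[OF that(1)] that(2) by simp
    then show ?thesis unfolding ball_simps sum.insert[OF insert(1,2)] prod.insert[OF insert(1,2)] eqs g_def
      by (auto simp: ennreal_mult'[symmetric] mult.assoc algebra_simps indicator_def)
  qed
  have "(\<integral>\<^sup>+ y. (if (\<forall>i\<in>insert j J. 0 < y i) \<and> (\<Sum>i\<in>insert j J. y i) < s
        then ennreal ((\<Prod>i\<in>insert j J. y i powr (a i - 1)) * (s - (\<Sum>i\<in>insert j J. y i)) powr (b - 1)) else 0) \<partial>(\<Pi>\<^sub>M i\<in>insert j J. lborel))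
     = (\<integral>\<^sup>+ t. (\<integral>\<^sup>+ y. indicator {0<..<s} t * ennreal (t powr (a j - 1)) * g (s - t) y \<partial>(\<Pi>\<^sub>M i\<in>J. lborel)) \<partial>lborel)"
    unfolding split[symmetric]
  proof (rule product_nn_integral_insert_rev)
    have "finite (insert j J)" by simp
    then show "(\<lambda>y. if (\<forall>i\<in>insert j J. 0 < y i) \<and> (\<Sum>i\<in>insert j J. y i) < s
        then ennreal ((\<Prod>i\<in>insert j J. y i powr (a i - 1)) * (s - (\<Sum>i\<in>insert j J. y i)) powr (b - 1)) else 0)
      \<in> borel_measurable (\<Pi>\<^sub>M i\<in>insert j J. lborel)"
      by measurable
  qed (use insert in auto)
  also have "\<dots> = (\<integral>\<^sup>+ t. indicator {0<..<s} t * ennreal (t powr (a j - 1)) * (\<integral>\<^sup>+ y. g (s - t) y \<partial>(\<Pi>\<^sub>M i\<in>J. lborel)) \<partial>lborel)"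
    unfolding g_def by (intro nn_integral_cong nn_integral_cmult) measurable
  also have "\<dots> = (\<integral>\<^sup>+ t. ennreal C * (indicator {0<..<s} t * ennreal (t powr (a j - 1) * (s - t) powr (A - 1))) \<partial>lborel)"
    by (intro nn_integral_cong) (use IH C in \<open>auto simp: indicator_def ennreal_mult'[symmetric] mult_ac\<close>)
  also have "\<dots> = ennreal C * ennreal (s powr (a j + A - 1) * Beta (a j) A)"
    by (subst nn_integral_cmult) (auto simp: nn_integral_Beta_scaled[OF j A insert.prems(3)])
  also have "\<dots> = ennreal (s powr (a j + A - 1) * (C * Beta (a j) A))"
    using C by (simp add: ennreal_mult'[symmetric] mult_ac)
  also have "C * Beta (a j) A = (\<Prod>i\<in>insert j J. Gamma (a i)) * Gamma b / Gamma ((\<Sum>i\<in>insert j J. a i) + b)"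
    using insert(1,2) Gamma_real_pos[OF A] by (simp add: C_def Beta_def A_def add_ac)
  also have "a j + A - 1 = (\<Sum>i\<in>insert j J. a i) + b - 1"
    using insert(1,2) by (simp add: A_def)
  finally show ?case .
qed

text \<open>
  Integrability of the integrand of \<open>simplex_integral\<close>, so that the latter is linear.
\<close>

definition simplex_integrable :: "nat \<Rightarrow> ((nat \<Rightarrow> real) \<Rightarrow> real) \<Rightarrow> bool" where
  "simplex_integrable d g \<longleftrightarrow>
     set_integrable (\<Pi>\<^sub>M i\<in>{1..<d}. lborel) {y \<in> {1..<d} \<rightarrow>\<^sub>E {0..}. (\<Sum>i\<in>{1..<d}. y i) \<le> 1}
        (\<lambda>y. g (y(d := 1 - (\<Sum>i\<in>{1..<d}. y i))))"

text \<open>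
  The set of integration includes the boundary of the simplex, where the integrand is 0 since
  \<open>0 powr a = 0\<close>. The formula for the open simplex with \<open>s = 1\<close> therefore applies without a null set argument.
\<close>

lemma Dirichlet_integral:
  assumes d: "d \<ge> 1" and a: "\<And>i. i \<in> {1..d} \<Longrightarrow> a i > 0"
  shows "simplex_integrable d (\<lambda>y. \<Prod>i=1..d. y i powr (a i - 1))"
    and "simplex_integral d (\<lambda>y. \<Prod>i=1..d. y i powr (a i - 1)) = (\<Prod>i=1..d. Gamma (a i)) / Gamma (\<Sum>i=1..d. a i)"
proof -
  let ?J = "{1..<d}" and ?M = "\<Pi>\<^sub>M i\<in>{1..<d}. (lborel :: real measure)"
  define S where "S = {y \<in> ?J \<rightarrow>\<^sub>E {0::real..}. (\<Sum>i\<in>?J. y i) \<le> 1}"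
  define ext where "ext = (\<lambda>y::nat \<Rightarrow> real. y(d := 1 - (\<Sum>i\<in>?J. y i)))"
  define h where "h = (\<lambda>y. if (\<forall>i\<in>?J. 0 < y i) \<and> (\<Sum>i\<in>?J. y i) < 1
        then (\<Prod>i\<in>?J. y i powr (a i - 1)) * (1 - (\<Sum>i\<in>?J. y i)) powr (a d - 1) else 0)"
  define r where "r = (\<Prod>i=1..d. Gamma (a i)) / Gamma (\<Sum>i=1..d. a i)"
  have ext_eq: "y(d := 1 - (\<Sum>i\<in>?J. y i)) = ext y" for y by (simp add: ext_def)
  have I: "{1..d} = insert d ?J" using d by auto
  have eq: "indicator S y *\<^sub>R (\<Prod>i=1..d. ext y i powr (a i - 1)) = h y" if sp: "y \<in> space ?M" for y
  proof -
    have p: "(\<Prod>i=1..d. ext y i powr (a i - 1)) = (1 - (\<Sum>i\<in>?J. y i)) powr (a d - 1) * (\<Prod>i\<in>?J. y i powr (a i - 1))"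
      unfolding I ext_def by (subst prod.insert) auto
    have ex: "y \<in> extensional ?J" using sp by (auto simp: space_PiM PiE_iff)
    show ?thesis
    proof (cases "(\<forall>i\<in>?J. 0 < y i) \<and> (\<Sum>i\<in>?J. y i) < 1")
      case True
      then have "y \<in> S" using ex by (auto simp: S_def PiE_iff less_imp_le)
      then show ?thesis unfolding p using True by (simp add: h_def mult.commute)
    next
      case False
      have "(\<Prod>i=1..d. ext y i powr (a i - 1)) = 0" if yS: "y \<in> S"
      proof (cases "(\<Sum>i\<in>?J. y i) = 1")
        case False
        then obtain i where "i \<in> ?J" "y i = 0"
          using \<open>\<not> (_ \<and> _)\<close> yS by (force simp: S_def PiE_iff)
        then have "(\<Prod>i\<in>?J. y i powr (a i - 1)) = 0" by (intro prod_zero) auto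
        then show ?thesis unfolding p by simp
      next
        case True
        show ?thesis unfolding p True by simp
      qed
      then have "indicator S y *\<^sub>R (\<Prod>i=1..d. ext y i powr (a i - 1)) = 0"
        by (cases "y \<in> S") (simp_all only: indicator_simps(2) scaleR_zero_left scaleR_zero_right simp_thms)
      moreover have "h y = 0" using False by (simp only: h_def if_False)
      ultimately show ?thesis by (simp only:)
    qed
  qed
  have hm: "h \<in> borel_measurable ?M" unfolding h_def by measurable
  have h0: "h y \<ge> 0" for y by (auto simp: h_def intro!: mult_nonneg_nonneg prod_nonneg)
  have "(\<integral>\<^sup>+ y. ennreal (h y) \<partial>?M) = ennreal (1 powr ((\<Sum>i\<in>?J. a i) + a d - 1) * ((\<Prod>i\<in>?J. Gamma (a i)) * Gamma (a d) / Gamma ((\<Sum>i\<in>?J. a i) + a d)))"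
    unfolding h_def by (subst nn_integral_Dirichlet_scaled[symmetric]) (use a d in \<open>auto intro!: nn_integral_cong\<close>)
  also have "\<dots> = ennreal r"
    unfolding r_def I by (simp add: add.commute mult.commute)
  finally have nn: "(\<integral>\<^sup>+ y. ennreal (h y) \<partial>?M) = ennreal r" .
  have "(\<Sum>i=1..d. a i) > 0" using a d by (intro sum_pos) auto
  then have "r \<ge> 0" unfolding r_def
    by (intro divide_nonneg_nonneg prod_nonneg) (use a in \<open>auto intro: less_imp_le Gamma_real_pos\<close>)
  with nn h0 hm have hb: "has_bochner_integral ?M h r"
    by (intro has_bochner_integral_nn_integral) auto
  show "simplex_integrable d (\<lambda>y. \<Prod>i=1..d. y i powr (a i - 1))"
    unfolding simplex_integrable_def set_integrable_def S_def[symmetric] ext_eq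
    using hb by (subst Bochner_Integration.integrable_cong[OF refl eq]) (auto simp: has_bochner_integral_iff)
  show "simplex_integral d (\<lambda>y. \<Prod>i=1..d. y i powr (a i - 1)) = (\<Prod>i=1..d. Gamma (a i)) / Gamma (\<Sum>i=1..d. a i)"
    unfolding simplex_integral_def set_lebesgue_integral_def S_def[symmetric] ext_eq r_def[symmetric]
    using hb by (subst Bochner_Integration.integral_cong[OF refl eq]) (auto simp: has_bochner_integral_iff)
qed

lemma simplex_integral_cong:
  assumes "d \<ge> 1"
    and "\<And>y. \<forall>i\<in>{1..d}. y i \<ge> 0 \<Longrightarrow> (\<Sum>i=1..d. y i) = 1 \<Longrightarrow> f y = g y"
  shows "simplex_integral d f = simplex_integral d g" "simplex_integrable d f \<longleftrightarrow> simplex_integrable d g"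
proof -
  let ?J = "{1..<d}"
  define ext where "ext = (\<lambda>y::nat \<Rightarrow> real. y(d := 1 - (\<Sum>i\<in>?J. y i)))"
  have ext_eq: "y(d := 1 - (\<Sum>i\<in>?J. y i)) = ext y" for y by (simp add: ext_def)
  have I: "{1..d} = insert d ?J" using assms(1) by auto
  have eq: "f (ext y) = g (ext y)" if "y \<in> {y \<in> ?J \<rightarrow>\<^sub>E {0..}. (\<Sum>i\<in>?J. y i) \<le> 1}" for y
  proof (rule assms(2))
    show "\<forall>i\<in>{1..d}. ext y i \<ge> 0" using that by (auto simp: ext_def PiE_iff)
    have "(\<Sum>i\<in>?J. ext y i) = (\<Sum>i\<in>?J. y i)" by (intro sum.cong) (auto simp: ext_def)
    then show "(\<Sum>i=1..d. ext y i) = 1" unfolding I by (subst sum.insert) (auto simp: ext_def)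
  qed
  show "simplex_integral d f = simplex_integral d g"
    unfolding simplex_integral_def set_lebesgue_integral_def ext_eq
    by (intro Bochner_Integration.integral_cong refl) (use eq in \<open>auto simp: indicator_def\<close>)
  show "simplex_integrable d f \<longleftrightarrow> simplex_integrable d g"
    unfolding simplex_integrable_def set_integrable_def ext_eq
    by (intro Bochner_Integration.integrable_cong refl) (use eq in \<open>auto simp: indicator_def\<close>)
qed

lemma
  assumes "\<And>j. j \<in> J \<Longrightarrow> simplex_integrable d (f j)"
  shows simplex_integrable_sum: "simplex_integrable d (\<lambda>y. \<Sum>j\<in>J. c j * f j y)"
    and simplex_integral_sum: "simplex_integral d (\<lambda>y. \<Sum>j\<in>J. c j * f j y) = (\<Sum>j\<in>J. c j * simplex_integral d (f j))"
  using assms unfolding simplex_integral_def simplex_integrable_def set_lebesgue_integral_def set_integrable_def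
  by (simp_all add: sum_distrib_left mult.left_commute)

text \<open>
  The moments of the Dirichlet distribution with parameters \<open>l i + 1\<close>. Multiplying the density by a monomial
  shifts the parameters, and the quotients of Gamma values become Pochhammer symbols.
\<close>

lemma simplex_moment:
  assumes d: "d \<ge> 1" and l: "\<forall>i\<in>{1..d}. l i > - (1/2)"
  shows "simplex_integrable d (\<lambda>y. (\<Prod>i=1..d. y i ^ \<alpha> i) * (\<Prod>i=1..d. y i powr l i))" (is ?A)
    and "simplex_const d l * simplex_integral d (\<lambda>y. (\<Prod>i=1..d. y i ^ \<alpha> i) * (\<Prod>i=1..d. y i powr l i)) =
      (\<Prod>i=1..d. pochhammer (l i + 1) (\<alpha> i)) / pochhammer ((\<Sum>i=1..d. l i) + real d) (\<Sum>i=1..d. \<alpha> i)" (is ?B)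
proof -
  define a where "a = (\<lambda>i. l i + 1 + real (\<alpha> i))"
  have l1: "l i + 1 > 0" if "i \<in> {1..d}" for i using l that by force
  have a: "a i > 0" if "i \<in> {1..d}" for i using l1[OF that] by (simp add: a_def add_pos_nonneg)
  have eq: "(\<Prod>i=1..d. y i powr (a i - 1)) = (\<Prod>i=1..d. y i ^ \<alpha> i) * (\<Prod>i=1..d. y i powr l i)"
    if y: "\<forall>i\<in>{1..d}. y i \<ge> 0" for y
    unfolding prod.distrib[symmetric]
  proof (intro prod.cong refl)
    fix i assume "i \<in> {1..d}"
    with y have "y i = 0 \<or> y i > 0" by (metis le_less)
    then show "y i powr (a i - 1) = y i ^ \<alpha> i * y i powr l i"
      by (auto simp: a_def powr_add powr_realpow)
  qed
  have cong: "simplex_integral d (\<lambda>y. \<Prod>i=1..d. y i powr (a i - 1)) =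
      simplex_integral d (\<lambda>y. (\<Prod>i=1..d. y i ^ \<alpha> i) * (\<Prod>i=1..d. y i powr l i))"
    "simplex_integrable d (\<lambda>y. \<Prod>i=1..d. y i powr (a i - 1)) =
      simplex_integrable d (\<lambda>y. (\<Prod>i=1..d. y i ^ \<alpha> i) * (\<Prod>i=1..d. y i powr l i))"
    by (rule simplex_integral_cong[OF d], rule eq, assumption)+
  note Dirichlet = Dirichlet_integral[of d a, OF d a]
  show ?A using Dirichlet(1) unfolding cong(2) .
  define s where "s = (\<Sum>i=1..d. l i) + real d"
  have s: "s = (\<Sum>i=1..d. l i + 1)" by (simp add: s_def sum.distrib)
  have spos: "s > 0" unfolding s using l1 d by (intro sum_pos) auto
  have asum: "(\<Sum>i=1..d. a i) = s + real (\<Sum>i=1..d. \<alpha> i)" by (simp add: a_def s sum.distrib)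
  have G: "Gamma (a i) = pochhammer (l i + 1) (\<alpha> i) * Gamma (l i + 1)" if "i \<in> {1..d}" for i
  proof -
    have "l i + 1 > 0" using l that by force
    then have "Gamma (l i + 1) \<noteq> 0" "l i + 1 \<notin> \<int>\<^sub>\<le>\<^sub>0" by (auto simp: Gamma_eq_zero_iff)
    then show ?thesis using pochhammer_Gamma[of "l i + 1" "\<alpha> i"] by (simp add: a_def)
  qed
  have "s \<notin> \<int>\<^sub>\<le>\<^sub>0" "Gamma s \<noteq> 0" using spos by (auto simp: Gamma_eq_zero_iff)
  then have Gs: "Gamma (s + real n) = pochhammer s n * Gamma s" for n
    using pochhammer_Gamma[of s n] by simp
  have P: "(\<Prod>i=1..d. Gamma (l i + 1)) \<noteq> 0"
  proof -
    have "Gamma (l i + 1) \<noteq> 0" if "i \<in> {1..d}" for i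
      using l that by (force simp: Gamma_eq_zero_iff dest: nonpos_Ints_nonpos)
    then show ?thesis by (simp add: prod_zero_iff)
  qed
  have "simplex_integral d (\<lambda>y. (\<Prod>i=1..d. y i ^ \<alpha> i) * (\<Prod>i=1..d. y i powr l i))
      = (\<Prod>i=1..d. pochhammer (l i + 1) (\<alpha> i) * Gamma (l i + 1)) / (pochhammer s (\<Sum>i=1..d. \<alpha> i) * Gamma s)"
    using Dirichlet(2) G unfolding cong(1) asum Gs by simp
  then show ?B unfolding simplex_const_def s_def[symmetric]
    using P \<open>Gamma s \<noteq> 0\<close> by (simp add: prod.distrib)
qed

section \<open>Averaging the generating function over the simplex\<close>

text \<open>
  The subtracted polynomial of index \<open>n - 2\<close> in the definition of \<open>zonal\<close> is the factor \<open>1 - X\<^sup>2\<close>.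
\<close>

lemma zonal_generating:
  "Abs_fps (\<lambda>n. poly (zonal \<nu> n) t) = (1 - fps_X\<^sup>2) * neg_power (\<nu> + 1) (geg_kernel_arg t)"
proof (rule fps_ext)
  fix n
  have "poly (zonal \<nu> n) t = poly (geg_poly (\<nu> + 1) n) t - (if n < 2 then 0 else poly (geg_poly (\<nu> + 1) (n - 2)) t)"
    by (cases n; cases "n - 1") (simp_all add: zonal_def)
  then show "fps_nth (Abs_fps (\<lambda>n. poly (zonal \<nu> n) t)) n
      = fps_nth ((1 - fps_X\<^sup>2) * neg_power (\<nu> + 1) (geg_kernel_arg t)) n"
    unfolding geg_poly_generating by (simp add: left_diff_distrib fps_X_power_mult_nth)
qed

text \<open>
  The expectation of \<open>g\<close> under the Dirichlet distribution with parameters \<open>l i + 1\<close>.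
\<close>

definition dirichlet_mean :: "nat \<Rightarrow> (nat \<Rightarrow> real) \<Rightarrow> ((nat \<Rightarrow> real) \<Rightarrow> real) \<Rightarrow> real" where
  "dirichlet_mean d l g = simplex_const d l * simplex_integral d (\<lambda>y. g y * (\<Prod>i=1..d. y i powr l i))"

text \<open>
  The formula of Liouville and Feynman for formal power series. In \<open>geg_poly_barycentric\<close> the monomial in \<open>y\<close>
  with exponents \<open>\<alpha>\<close> of sum \<open>k\<close> carries the factor \<open>pochhammer s k\<close>, which is exactly the denominator of its
  Dirichlet moment. What remains are the numerators \<open>pochhammer (l i + 1) (\<alpha> i)\<close>, one for each factor of
  \<open>prod_neg_power_nth\<close>.
\<close>

lemma dirichlet_mean_geg_poly:
  assumes d: "d \<ge> 1" and l: "\<forall>i\<in>{1..d}. l i > - (1/2)"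
  defines "s \<equiv> (\<Sum>i=1..d. l i) + real d"
  shows "simplex_integrable d (\<lambda>y. poly (geg_poly s n) (\<Sum>i=1..d. x i * y i) * (\<Prod>i=1..d. y i powr l i))" (is ?A)
    and "dirichlet_mean d l (\<lambda>y. poly (geg_poly s n) (\<Sum>i=1..d. x i * y i)) =
      fps_nth (\<Prod>i=1..d. neg_power (l i + 1) (geg_kernel_arg (x i))) n" (is ?B)
proof -
  let ?T = "Sigma {..n} (compositions {1..d})"
  define c where "c = (\<lambda>(k, \<alpha>). pochhammer s k / (\<Prod>i=1..d. fact (\<alpha> i)) * fps_nth (\<Prod>i=1..d. geg_kernel_arg (x i) ^ \<alpha> i) n)"
  define m where "m = (\<lambda>(k :: nat, \<alpha>) y. (\<Prod>i=1..d. y i ^ \<alpha> i) * (\<Prod>i=1..d. y i powr l i) :: real)"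
  have eq: "poly (geg_poly s n) (\<Sum>i=1..d. x i * y i) * (\<Prod>i=1..d. y i powr l i) = (\<Sum>j\<in>?T. c j * m j y)"
    if "(\<Sum>i=1..d. y i) = 1" for y
  proof -
    have "poly (geg_poly s n) (\<Sum>i=1..d. x i * y i) = (\<Sum>(k, \<alpha>)\<in>?T. pochhammer s k * (\<Prod>i=1..d. y i ^ \<alpha> i / fact (\<alpha> i))
       * fps_nth (\<Prod>i=1..d. geg_kernel_arg (x i) ^ \<alpha> i) n)"
      unfolding geg_poly_barycentric[OF finite_atLeastAtMost that]
      by (rule sum.Sigma) (auto simp: finite_compositions)
    also have "\<dots> * (\<Prod>i=1..d. y i powr l i) = (\<Sum>j\<in>?T. c j * m j y)"
      unfolding sum_distrib_right
      by (intro sum.cong refl) (auto simp: c_def m_def prod_dividef)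
    finally show ?thesis .
  qed
  have cong: "simplex_integral d (\<lambda>y. poly (geg_poly s n) (\<Sum>i=1..d. x i * y i) * (\<Prod>i=1..d. y i powr l i))
      = simplex_integral d (\<lambda>y. \<Sum>j\<in>?T. c j * m j y)"
    "simplex_integrable d (\<lambda>y. poly (geg_poly s n) (\<Sum>i=1..d. x i * y i) * (\<Prod>i=1..d. y i powr l i))
      = simplex_integrable d (\<lambda>y. \<Sum>j\<in>?T. c j * m j y)"
    by (rule simplex_integral_cong[OF d], rule eq, assumption)+
  have mi: "simplex_integrable d (m j)" for j
    using simplex_moment(1)[OF d l] by (cases j) (simp add: m_def)
  show ?A unfolding cong by (rule simplex_integrable_sum) (rule mi)
  have s: "s > 0"
  proof -
    have "s = (\<Sum>i=1..d. l i + 1)" by (simp add: s_def sum.distrib)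
    moreover have "l i + 1 > 0" if "i \<in> {1..d}" for i using l that by force
    ultimately show ?thesis using d by (auto intro!: sum_pos)
  qed
  have "dirichlet_mean d l (\<lambda>y. poly (geg_poly s n) (\<Sum>i=1..d. x i * y i))
      = (\<Sum>j\<in>?T. c j * (simplex_const d l * simplex_integral d (m j)))"
    unfolding dirichlet_mean_def cong simplex_integral_sum[OF mi] by (simp add: sum_distrib_left mult.left_commute)
  also have "\<dots> = (\<Sum>(k, \<alpha>)\<in>?T. (\<Prod>i=1..d. pochhammer (l i + 1) (\<alpha> i) / fact (\<alpha> i))
      * fps_nth (\<Prod>i=1..d. geg_kernel_arg (x i) ^ \<alpha> i) n)"
  proof (intro sum.cong refl)
    fix j assume "j \<in> ?T"
    then obtain k \<alpha> where j: "j = (k, \<alpha>)" "\<alpha> \<in> compositions {1..d} k" by auto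
    have k: "(\<Sum>i=1..d. \<alpha> i) = k" using j by (simp add: compositions_def)
    have "pochhammer s k \<noteq> 0" using s by (simp add: pochhammer_pos less_imp_neq[symmetric])
    moreover have "simplex_const d l * simplex_integral d (m j) = (\<Prod>i=1..d. pochhammer (l i + 1) (\<alpha> i)) / pochhammer s k"
      using simplex_moment(2)[OF d l, of \<alpha>] unfolding k s_def[symmetric] by (simp add: j m_def)
    ultimately show "c j * (simplex_const d l * simplex_integral d (m j)) =
      (case j of (k, \<alpha>) \<Rightarrow> (\<Prod>i=1..d. pochhammer (l i + 1) (\<alpha> i) / fact (\<alpha> i))
      * fps_nth (\<Prod>i=1..d. geg_kernel_arg (x i) ^ \<alpha> i) n)"
      by (simp add: j c_def prod_dividef)
  qed
  also have "\<dots> = (\<Sum>k\<le>n. \<Sum>\<alpha>\<in>compositions {1..d} k. (\<Prod>i=1..d. pochhammer (l i + 1) (\<alpha> i) / fact (\<alpha> i))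
      * fps_nth (\<Prod>i=1..d. geg_kernel_arg (x i) ^ \<alpha> i) n)"
    by (rule sum.Sigma[symmetric]) (auto simp: finite_compositions)
  also have "\<dots> = fps_nth (\<Prod>i=1..d. neg_power (l i + 1) (geg_kernel_arg (x i))) n"
    by (rule prod_neg_power_nth[symmetric]) (auto simp: geg_kernel_arg_def)
  finally show ?B .
qed

lemma dirichlet_mean_zonal_generating:
  assumes d: "d \<ge> 1" and l: "\<forall>i\<in>{1..d}. l i > - (1/2)"
  defines "\<nu> \<equiv> (\<Sum>i=1..d. l i) + real d - 1"
  shows "Abs_fps (\<lambda>n. dirichlet_mean d l (\<lambda>y. poly (zonal \<nu> n) (\<Sum>i=1..d. x i * y i))) =
    (1 - fps_X\<^sup>2) * (\<Prod>i=1..d. neg_power (l i + 1) (geg_kernel_arg (x i)))"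
proof (rule fps_ext)
  fix n
  define N where "N = (\<Prod>i=1..d. neg_power (l i + 1) (geg_kernel_arg (x i)))"
  define g where "g = (\<lambda>n y. poly (geg_poly (\<nu> + 1) n) (\<Sum>i=1..d. x i * y i))"
  have nu1: "\<nu> + 1 = (\<Sum>i=1..d. l i) + real d" by (simp add: \<nu>_def)
  have int: "simplex_integrable d (\<lambda>y. g n y * (\<Prod>i=1..d. y i powr l i))"
    and mean: "dirichlet_mean d l (g n) = fps_nth N n" for n
    using dirichlet_mean_geg_poly[OF d l, of n x] unfolding g_def N_def nu1 by blast+
  have diff: "dirichlet_mean d l (\<lambda>y. g n y - g m y) = fps_nth N n - fps_nth N m" for n m
    unfolding mean[symmetric] dirichlet_mean_def left_diff_distrib right_diff_distrib[symmetric]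
    using int[of n] int[of m]
    unfolding simplex_integral_def simplex_integrable_def by (simp add: set_integral_diff)
  have "dirichlet_mean d l (\<lambda>y. poly (zonal \<nu> n) (\<Sum>i=1..d. x i * y i)) = fps_nth N n - (if n < 2 then 0 else fps_nth N (n - 2))"
  proof (cases "n < 2")
    case True
    then have "n - 1 = 0" by simp
    then have "zonal \<nu> n = geg_poly (\<nu> + 1) n" by (simp add: zonal_def)
    then show ?thesis using True mean[of n] by (simp add: g_def)
  next
    case False
    then obtain m where m: "n = Suc (Suc m)" by (metis add_2_eq_Suc le_Suc_ex not_less)
    show ?thesis using diff[of n m] by (simp add: m zonal_def g_def)
  qed
  then show "fps_nth (Abs_fps (\<lambda>n. dirichlet_mean d l (\<lambda>y. poly (zonal \<nu> n) (\<Sum>i=1..d. x i * y i)))) n =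
    fps_nth ((1 - fps_X\<^sup>2) * (\<Prod>i=1..d. neg_power (l i + 1) (geg_kernel_arg (x i)))) n"
    by (simp add: N_def left_diff_distrib fps_X_power_mult_nth)
qed

text \<open>
  Of the \<open>d\<close> factors \<open>1 - X\<^sup>2\<close> contributed by the coordinates, one is absorbed in the zonal polynomials of
  parameter \<open>|\<lambda>| + d - 1\<close>.
\<close>

lemma repr_kernel_generating:
  assumes d: "d \<ge> 1" and l: "\<forall>i\<in>{1..d}. l i > - (1/2)"
  shows "Abs_fps (\<lambda>n. repr_kernel d l n x (\<lambda>_. 1)) =
    (1 - fps_X\<^sup>2) ^ (d - 1) *
      Abs_fps (\<lambda>n. dirichlet_mean d l (\<lambda>y. poly (zonal ((\<Sum>i=1..d. l i) + real d - 1) n) (\<Sum>i=1..d. x i * y i)))"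
proof -
  have "Abs_fps (\<lambda>n. repr_kernel d l n x (\<lambda>_. 1)) = (\<Prod>i=1..d. Abs_fps (\<lambda>k. poly (zonal (l i) k) (x i)))"
    by (rule fps_ext) (simp add: repr_kernel_one[OF l] fps_nth_prod_compositions zonal_prod_def)
  also have "\<dots> = (1 - fps_X\<^sup>2) ^ d * (\<Prod>i=1..d. neg_power (l i + 1) (geg_kernel_arg (x i)))"
    by (simp add: zonal_generating prod.distrib)
  also have "(1 - fps_X\<^sup>2) ^ d = (1 - fps_X\<^sup>2 :: real fps) ^ (d - 1) * (1 - fps_X\<^sup>2)"
    using d by (simp flip: power_Suc2)
  finally show ?thesis using dirichlet_mean_zonal_generating[OF d l, of x] by (simp add: mult.assoc)
qed

lemma fps_nth_one_plus_power_mult: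
  fixes P :: "real fps"
  assumes "p > 0"
  shows "fps_nth ((1 + fps_const c * fps_X ^ p) ^ r * P) n =
    (\<Sum>m=0..min (n div p) r. c ^ m * real (r choose m) * fps_nth P (n - p * m))"
proof -
  have "(1 + fps_const c * fps_X ^ p) ^ r * P =
      (\<Sum>m\<le>r. fps_const (real (r choose m) * c ^ m) * (fps_X ^ (p * m) * P))"
    by (subst add.commute, subst binomial_ring)
       (simp add: sum_distrib_right power_mult_distrib fps_const_power power_mult[symmetric] mult.assoc
          fps_of_nat[symmetric] flip: fps_const_mult)
  then have "fps_nth ((1 + fps_const c * fps_X ^ p) ^ r * P) n =
      (\<Sum>m\<le>r. real (r choose m) * c ^ m * (if n < p * m then 0 else fps_nth P (n - p * m)))"
    by (simp add: fps_sum_nth fps_X_power_mult_nth)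
  also have "\<dots> = (\<Sum>m=0..min (n div p) r. c ^ m * real (r choose m) * fps_nth P (n - p * m))"
    using assms by (intro sum.mono_neutral_cong_right)
      (auto simp: less_eq_div_iff_mult_less_eq not_le mult.commute)
  finally show ?thesis .
qed

lemma cesaro_weights_generating:
  assumes "d \<ge> 2"
  shows "Abs_fps (\<lambda>k. (real k + (real d - 2)) gchoose k) * (1 - fps_X) ^ (d - 1) = 1"
proof -
  have "(real k + (real d - 2)) gchoose k = real ((d - 1 + k - 1) choose k)" for k
    using assms by (simp add: binomial_gbinomial of_nat_diff algebra_simps)
  then have "Abs_fps (\<lambda>k. (real k + (real d - 2)) gchoose k) = inverse ((1 - fps_X) ^ (d - 1))"
    using one_minus_const_fps_X_neg_power'[of "d - 1" "1 :: real"] assms by simp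
  then show ?thesis by (simp add: inverse_mult_eq_1)
qed

text \<open>
  Cesaro summation multiplies the generating function by \<open>1 / (1 - X)^(d - 1)\<close>, and
  \<open>1 - X\<^sup>2 = (1 - X) (1 + X)\<close>.
\<close>

lemma cesaro_generating:
  assumes d: "d \<ge> 2" and l: "\<forall>i\<in>{1..d}. l i > - (1/2)"
  shows "(\<Sum>k=0..n. ((real (n - k) + (real d - 2)) gchoose (n - k)) * repr_kernel d l k x (\<lambda>_. 1)) =
    fps_nth ((1 + fps_X) ^ (d - 1) *
      Abs_fps (\<lambda>n. dirichlet_mean d l (\<lambda>y. poly (zonal ((\<Sum>i=1..d. l i) + real d - 1) n) (\<Sum>i=1..d. x i * y i)))) n"
proof -
  define W where "W = Abs_fps (\<lambda>k. (real k + (real d - 2)) gchoose k)"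
  define P where "P = Abs_fps (\<lambda>n. dirichlet_mean d l (\<lambda>y. poly (zonal ((\<Sum>i=1..d. l i) + real d - 1) n) (\<Sum>i=1..d. x i * y i)))"
  have sq: "(1 - fps_X\<^sup>2 :: real fps) = (1 - fps_X) * (1 + fps_X)"
    by (simp add: algebra_simps power2_eq_square)
  have "Abs_fps (\<lambda>n. repr_kernel d l n x (\<lambda>_. 1)) = (1 - fps_X\<^sup>2) ^ (d - 1) * P"
    unfolding P_def using d l by (intro repr_kernel_generating) auto
  then have "Abs_fps (\<lambda>n. repr_kernel d l n x (\<lambda>_. 1)) * W = (W * (1 - fps_X) ^ (d - 1)) * ((1 + fps_X) ^ (d - 1) * P)"
    unfolding sq by (simp only: power_mult_distrib mult_ac)
  also have "\<dots> = (1 + fps_X) ^ (d - 1) * P"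
    using cesaro_weights_generating[OF d] by (simp add: W_def)
  finally have prod: "Abs_fps (\<lambda>n. repr_kernel d l n x (\<lambda>_. 1)) * W = (1 + fps_X) ^ (d - 1) * P" .
  show ?thesis
    unfolding P_def[symmetric] prod[symmetric] W_def fps_mult_nth by (simp add: mult.commute)
qed

theorem theorem3p1:
  fixes d n :: nat and l x :: "nat \<Rightarrow> real"
  assumes "d \<ge> 2"
    and "\<forall>i\<in>{1..d}. l i > - (1/2)"
    and "\<forall>i\<in>{1..d}. x i \<in> {-1..1}"
  shows "repr_kernel d l n x (\<lambda>_. 1) =
      (\<Sum>m=0..min (n div 2) (d - 1).
         (-1) ^ m * real ((d - 1) choose m) * simplex_const d l *
         simplex_integral d (\<lambda>y. geg_Z ((\<Sum>i=1..d. l i) + real d - 1) (n - 2 * m) (\<Sum>i=1..d. x i * y i)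
           * (\<Prod>i=1..d. y i powr l i)))
    \<and> cesaro_kernel d l (real d - 2) n x (\<lambda>_. 1) =
      1 / real ((n + d - 2) choose n) *
      (\<Sum>m=0..min n (d - 1).
         real ((d - 1) choose m) * simplex_const d l *
         simplex_integral d (\<lambda>y. geg_Z ((\<Sum>i=1..d. l i) + real d - 1) (n - m) (\<Sum>i=1..d. x i * y i)
           * (\<Prod>i=1..d. y i powr l i)))"
proof -
  define \<nu> where "\<nu> = (\<Sum>i=1..d. l i) + real d - 1"
  define M where "M = (\<lambda>k. dirichlet_mean d l (\<lambda>y. poly (zonal \<nu> k) (\<Sum>i=1..d. x i * y i)))"
  note d = assms(1) and l = assms(2)
  have d1: "d \<ge> 1" using d by simp
  \<comment> \<open>The parameter exceeds \<open>- d/2 + d - 1\<close>, which is nonnegative for \<open>d \<ge> 2\<close>.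
      Hence the limiting case of \<open>geg_Z\<close> does not occur.\<close>
  have "(\<Sum>i=1..d. - (1/2)) < (\<Sum>i=1..d. l i)"
    using l d by (intro sum_strict_mono) auto
  then have "\<nu> > 0" using d by (simp add: \<nu>_def field_simps)
  then have Z: "simplex_const d l * simplex_integral d (\<lambda>y. geg_Z \<nu> k (\<Sum>i=1..d. x i * y i)
           * (\<Prod>i=1..d. y i powr l i)) = M k" for k
    by (simp add: geg_Z_eq_zonal M_def dirichlet_mean_def)
  have "repr_kernel d l n x (\<lambda>_. 1) = fps_nth ((1 + fps_const (-1) * fps_X ^ 2) ^ (d - 1) * Abs_fps M) n"
    using arg_cong[OF repr_kernel_generating[OF d1 l, of x, folded \<nu>_def, folded M_def], of "\<lambda>f. fps_nth f n"]
    by (simp flip: fps_const_neg)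
  also have "\<dots> = (\<Sum>m=0..min (n div 2) (d - 1). (-1) ^ m * real ((d - 1) choose m) * M (n - 2 * m))"
    by (simp add: fps_nth_one_plus_power_mult)
  finally have 1: "repr_kernel d l n x (\<lambda>_. 1) =
      (\<Sum>m=0..min (n div 2) (d - 1). (-1) ^ m * real ((d - 1) choose m) * M (n - 2 * m))" .
  have "(\<Sum>k=0..n. ((real (n - k) + (real d - 2)) gchoose (n - k)) * repr_kernel d l k x (\<lambda>_. 1)) =
      fps_nth ((1 + fps_const 1 * fps_X ^ 1) ^ (d - 1) * Abs_fps M) n"
    using cesaro_generating[OF d l, of n x, folded \<nu>_def, folded M_def] by simp
  also have "\<dots> = (\<Sum>m=0..min n (d - 1). real ((d - 1) choose m) * M (n - m))"
    using fps_nth_one_plus_power_mult[of 1 1 "d - 1" "Abs_fps M" n] by simp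
  finally have 2: "(\<Sum>k=0..n. ((real (n - k) + (real d - 2)) gchoose (n - k)) * repr_kernel d l k x (\<lambda>_. 1)) =
      (\<Sum>m=0..min n (d - 1). real ((d - 1) choose m) * M (n - m))" .
  have 3: "(real n + (real d - 2)) gchoose n = real ((n + d - 2) choose n)"
    using d by (simp add: binomial_gbinomial of_nat_diff algebra_simps)
  show ?thesis unfolding cesaro_kernel_def 1 2 3 \<nu>_def[symmetric] by (simp only: mult.assoc Z)
qed

end
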